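(* Let $\mathcal{A},\mathcal{B}\in\mathbb{R}^{n\times n\times n_3}$ with $\mathcal{A}\ge\mathcal{B}\ge0$. Then $$(\mathcal{B}^r*\mathcal{A}^p*\mathcal{B}^r)^{1/q}\ge\mathcal{B}^{(p+2r)/q}$$ and $$\mathcal{A}^{(p+2r)/q}\ge(\mathcal{A}^r*\mathcal{B}^p*\mathcal{A}^r)^{1/q}$$ for all real numbers $r\ge0$, $p\ge0$, $q\ge1$ with $(1+2r)q\ge p+2r$.
   Context: For $\mathcal{A}\in\mathbb{R}^{n_1\times n_2\times n_3}$ with frontal slices $A^{(1)},\dots,A^{(n_3)}$ (each $n_1\times n_2$), $\mathrm{bcirc}(\mathcal{A})$ is the $n_1n_3\times n_2n_3$ block circulant matrix whose first block column is $A^{(1)},A^{(2)},\dots,A^{(n_3)}$ (top to bottom), i.e. its $(i,j)$ block is $A^{(((i-j)\bmod n_3)+1)}$. $\mathrm{unfold}(\mathcal{A})$ is the first block column of $\mathrm{bcirc}(\mathcal{A})$ and $\mathrm{fold}$ is its inverse. The t-product of $\mathcal{A}\in\mathbb{R}^{n_1\times n_2\times n_3}$ and $\mathcal{B}\in\mathbb{R}^{n_2\times n_4\times n_3}$ is $\mathcal{A}*\mathcal{B}=\mathrm{fold}(\mathrm{bcirc}(\mathcal{A})\cdot\mathrm{unfold}(\mathcal{B}))\in\mathbb{R}^{n_1\times n_4\times n_3}$. The transpose $\mathcal{A}^{T}$ is obtained by transposing each frontal slice and reversing the order of the transposed slices $2,\dots,n_3$; $\mathcal{A}$ is symmetric if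 $\mathcal{A}^T=\mathcal{A}$. The inner product is $\langle\mathcal{X},\mathcal{Y}\rangle=\sum_{i,j,k}x_{ijk}y_{ijk}$. A tensor $\mathcal{A}\in\mathbb{R}^{n\times n\times n_3}$ is symmetric t-positive semidefinite, written $\mathcal{A}\ge0$, if it is symmetric and $\langle\mathcal{X},\mathcal{A}*\mathcal{X}\rangle\ge0$ for all nonzero $\mathcal{X}\in\mathbb{R}^{n\times1\times n_3}$. For symmetric tensors, $\mathcal{A}\ge\mathcal{B}$ (equivalently $\mathcal{B}\le\mathcal{A}$) means $\mathcal{A}-\mathcal{B}\ge0$. For $\mathcal{A}\ge0$ and a real number $r\ge0$, the power $\mathcal{A}^r$ (a tensor t-function) is the tensor with $\mathrm{bcirc}(\mathcal{A}^r)=(\mathrm{bcirc}(\mathcal{A}))^r$, the usual power of a positive semidefinite matrix. The zeroth power is the identity tensor (first frontal slice $I_n$, other slices zero). *)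

theory Defs
  imports Complex_Main "Jordan_Normal_Form.Matrix"
begin

text \<open>
  A third-order tensor in $R^{n_1 \times n_2 \times n_3}$ is the list of its $n_3$ frontal
  slices. Indices start at 0, so the slice \<open>A ! k\<close> is the mathematical $A^{(k+1)}$.
\<close>

type_synonym tensor = "real mat list"

definition carrier_tensor :: "nat \<Rightarrow> nat \<Rightarrow> nat \<Rightarrow> tensor set" where
  "carrier_tensor n1 n2 n3 = {A. length A = n3 \<and> set A \<subseteq> carrier_mat n1 n2}"

abbreviation (input) t_rows :: "tensor \<Rightarrow> nat" where
  "t_rows A \<equiv> dim_row (hd A)"

abbreviation (input) t_cols :: "tensor \<Rightarrow> nat" where
  "t_cols A \<equiv> dim_col (hd A)"

definition t_zero :: "nat \<Rightarrow> nat \<Rightarrow> nat \<Rightarrow> tensor" where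
  "t_zero n1 n2 n3 = replicate n3 (0\<^sub>m n1 n2)"

definition t_id :: "nat \<Rightarrow> nat \<Rightarrow> tensor" where
  "t_id n n3 = map (\<lambda>k. if k = 0 then 1\<^sub>m n else 0\<^sub>m n n) [0..<n3]"

definition t_minus :: "tensor \<Rightarrow> tensor \<Rightarrow> tensor" where
  "t_minus A B = map2 (-) A B"

text \<open>
  Row \<open>i\<close> lies in block row \<open>i div n1\<close>, column \<open>j\<close> in block column \<open>j div n2\<close>. As
  \<open>j div n2 < n3\<close>, adding \<open>n3\<close> before subtracting keeps the natural-number
  subtraction from truncating.
\<close>

definition bcirc :: "tensor \<Rightarrow> real mat" where
  "bcirc A = (let n1 = t_rows A; n2 = t_cols A; n3 = length A in
     mat (n1 * n3) (n2 * n3)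
       (\<lambda>(i, j). (A ! ((i div n1 + n3 - j div n2) mod n3)) $$ (i mod n1, j mod n2)))"

definition t_unfold :: "tensor \<Rightarrow> real mat" where
  "t_unfold A = mat (t_rows A * length A) (t_cols A) (\<lambda>(i, j). bcirc A $$ (i, j))"

definition t_fold :: "nat \<Rightarrow> real mat \<Rightarrow> tensor" where
  "t_fold n3 M = (let n1 = dim_row M div n3 in
     map (\<lambda>k. mat n1 (dim_col M) (\<lambda>(i, j). M $$ (k * n1 + i, j))) [0..<n3])"

definition t_prod :: "tensor \<Rightarrow> tensor \<Rightarrow> tensor" (infixl \<open>*\<^sub>t\<close> 70) where
  "A *\<^sub>t B = t_fold (length A) (bcirc A * t_unfold B)"

definition t_transpose :: "tensor \<Rightarrow> tensor" where
  "t_transpose A = (case map transpose_mat A of [] \<Rightarrow> [] | S # Ss \<Rightarrow> S # rev Ss)"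

definition t_symmetric :: "tensor \<Rightarrow> bool" where
  "t_symmetric A \<longleftrightarrow> t_transpose A = A"

definition t_inner :: "tensor \<Rightarrow> tensor \<Rightarrow> real" where
  "t_inner X Y =
     (\<Sum>i<t_rows X. \<Sum>j<t_cols X. \<Sum>k<length X. (X ! k) $$ (i, j) * (Y ! k) $$ (i, j))"

definition t_psd :: "nat \<Rightarrow> nat \<Rightarrow> tensor \<Rightarrow> bool" where
  "t_psd n n3 A \<longleftrightarrow> A \<in> carrier_tensor n n n3 \<and> t_symmetric A \<and>
     (\<forall>X \<in> carrier_tensor n 1 n3. X \<noteq> t_zero n 1 n3 \<longrightarrow> t_inner X (A *\<^sub>t X) \<ge> 0)"

definition t_ge :: "nat \<Rightarrow> nat \<Rightarrow> tensor \<Rightarrow> tensor \<Rightarrow> bool" where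
  "t_ge n n3 A B \<longleftrightarrow>
     A \<in> carrier_tensor n n n3 \<and> B \<in> carrier_tensor n n n3 \<and>
     t_symmetric A \<and> t_symmetric B \<and> t_psd n n3 (t_minus A B)"

text \<open>
  The power of a nonnegative number with the convention $0^0 = 1$ (but \<open>0 powr 0 = 0\<close>), so
  that the zeroth power of a matrix is the identity even if the matrix is singular.
\<close>

definition nonneg_pow :: "real \<Rightarrow> real \<Rightarrow> real" where
  "nonneg_pow x r = (if r = 0 then 1 else x powr r)"

text \<open>
  The power of a positive semidefinite matrix by spectral calculus: if $M = Q D Q^T$ with $Q$
  orthogonal and $D$ diagonal with nonnegative entries, then $M^r = Q D^r Q^T$, which does
  not depend on the chosen diagonalisation.
\<close>

definition is_psd_mat_pow :: "real mat \<Rightarrow> real \<Rightarrow> real mat \<Rightarrow> bool" where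
  "is_psd_mat_pow M r N \<longleftrightarrow> (let m = dim_row M in
     \<exists>Q d. Q \<in> carrier_mat m m \<and> transpose_mat Q * Q = 1\<^sub>m m \<and> Q * transpose_mat Q = 1\<^sub>m m \<and>
       (\<forall>i<m. 0 \<le> d i) \<and>
       M = Q * mat_diag m d * transpose_mat Q \<and>
       N = Q * mat_diag m (\<lambda>i. nonneg_pow (d i) r) * transpose_mat Q)"

definition psd_mat_pow :: "real mat \<Rightarrow> real \<Rightarrow> real mat" where
  "psd_mat_pow M r = (THE N. is_psd_mat_pow M r N)"

text \<open>Meaningful for $A \ge 0$ and $r \ge 0$ only.\<close>

definition t_pow :: "tensor \<Rightarrow> real \<Rightarrow> tensor" (infixr \<open>^\<^sub>t\<close> 80) where
  "A ^\<^sub>t r = (THE C. C \<in> carrier_tensor (t_rows A) (t_rows A) (length A) \<and>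
                    bcirc C = psd_mat_pow (bcirc A) r)"

lemma carrier_tensorD:
  assumes "A \<in> carrier_tensor n1 n2 n3"
  shows "length A = n3" "k < n3 \<Longrightarrow> A ! k \<in> carrier_mat n1 n2"
    "n3 > 0 \<Longrightarrow> dim_row (hd A) = n1" "n3 > 0 \<Longrightarrow> dim_col (hd A) = n2"
proof -
  show l: "length A = n3" using assms by (auto simp: carrier_tensor_def)
  show c: "k < n3 \<Longrightarrow> A ! k \<in> carrier_mat n1 n2" for k
    using assms l nth_mem[of k A] by (auto simp: carrier_tensor_def)
  have "n3 > 0 \<Longrightarrow> hd A \<in> carrier_mat n1 n2"
    using c[of 0] l by (cases A) simp_all
  then show "n3 > 0 \<Longrightarrow> dim_row (hd A) = n1" "n3 > 0 \<Longrightarrow> dim_col (hd A) = n2"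
    by simp_all
qed

lemma t_unfold_index:
  assumes A: "A \<in> carrier_tensor n1 n2 n3" and "k < n3" "i < n1" "j < n2"
  shows "t_unfold A $$ (k * n1 + i, j) = (A ! k) $$ (i, j)"
    and "bcirc A $$ (k * n1 + i, j) = (A ! k) $$ (i, j)"
proof -
  have n3: "n3 > 0" using assms by simp
  note d = carrier_tensorD(1)[OF A] carrier_tensorD(3,4)[OF A n3]
  have "k * n1 + i < Suc k * n1" using assms by simp
  also have "\<dots> \<le> n3 * n1" using assms by (intro mult_right_mono) auto
  finally have lt: "k * n1 + i < n1 * n3" by (simp add: mult.commute)
  have j: "j < n2 * n3" using \<open>j < n2\<close> n3 by (cases n3) auto
  have idx: "(k * n1 + i) div n1 = k" "(k * n1 + i) mod n1 = i" "j div n2 = 0" "j mod n2 = j"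
    "(k + n3 - 0) mod n3 = k"
    using \<open>k < n3\<close> \<open>i < n1\<close> \<open>j < n2\<close> by simp_all
  show *: "bcirc A $$ (k * n1 + i, j) = (A ! k) $$ (i, j)"
    unfolding bcirc_def Let_def d index_mat(1)[OF lt j] prod.case idx ..
  show "t_unfold A $$ (k * n1 + i, j) = (A ! k) $$ (i, j)"
    unfolding t_unfold_def d index_mat(1)[OF lt \<open>j < n2\<close>] prod.case * ..
qed

lemma t_fold_unfold:
  assumes A: "A \<in> carrier_tensor n1 n2 n3" and n3: "n3 > 0"
  shows "t_fold n3 (t_unfold A) = A"
proof (rule nth_equalityI)
  note d = carrier_tensorD(1)[OF A] carrier_tensorD(3,4)[OF A n3]
  have dims: "dim_row (t_unfold A) = n1 * n3" "dim_col (t_unfold A) = n2"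
    using d by (simp_all add: t_unfold_def)
  show "length (t_fold n3 (t_unfold A)) = length A" by (simp add: t_fold_def d Let_def)
  fix k assume "k < length (t_fold n3 (t_unfold A))"
  then have k: "k < n3" by (simp add: t_fold_def Let_def)
  show "t_fold n3 (t_unfold A) ! k = A ! k"
    using carrier_tensorD(2)[OF A k] k n3 dims t_unfold_index(1)[OF A k]
    by (intro eq_matI) (auto simp: t_fold_def Let_def)
qed

text \<open>Hence the description of \<open>t_pow\<close> determines at most one tensor.\<close>

lemma bcirc_inj:
  assumes A: "A \<in> carrier_tensor n1 n2 n3" and B: "B \<in> carrier_tensor n1 n2 n3"
    and n3: "n3 > 0" and eq: "bcirc A = bcirc B"
  shows "A = B"
proof -
  have "t_unfold A = t_unfold B"
    using eq carrier_tensorD(1)[OF A] carrier_tensorD(1)[OF B]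
      carrier_tensorD(3,4)[OF A n3] carrier_tensorD(3,4)[OF B n3]
    by (simp add: t_unfold_def)
  then show ?thesis using t_fold_unfold[OF A n3] t_fold_unfold[OF B n3] by metis
qed

lemma t_id_carrier: "t_id n n3 \<in> carrier_tensor n n n3"
  by (auto simp: t_id_def carrier_tensor_def)

lemma bcirc_t_id:
  assumes n: "n > 0" and n3: "n3 > 0"
  shows "bcirc (t_id n n3) = 1\<^sub>m (n * n3)"
proof (rule eq_matI)
  note d = carrier_tensorD(1)[OF t_id_carrier] carrier_tensorD(3,4)[OF t_id_carrier n3]
  show "dim_row (bcirc (t_id n n3)) = dim_row (1\<^sub>m (n * n3))"
    "dim_col (bcirc (t_id n n3)) = dim_col (1\<^sub>m (n * n3))"
    by (simp_all add: bcirc_def Let_def d)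
  fix i j assume "i < dim_row (1\<^sub>m (n * n3))" "j < dim_col (1\<^sub>m (n * n3))"
  then have ij: "i < n * n3" "j < n * n3" by simp_all
  define a b k where "a = i div n" and "b = j div n" and "k = (a + n3 - b) mod n3"
  have ab: "a < n3" "b < n3"
    using ij by (simp_all add: a_def b_def less_mult_imp_div_less mult.commute)
  have k: "k < n3" using n3 by (simp add: k_def)
  have k0: "k = 0 \<longleftrightarrow> a = b"
  proof (cases "a < b")
    case True
    then have "k = a + n3 - b" using ab by (simp add: k_def)
    then show ?thesis using True ab by simp
  next
    case False
    then have "a + n3 - b = (a - b) + n3" by simp
    then have "k = (a - b) mod n3" by (simp add: k_def)
    then have "k = a - b" using ab by simp
    then show ?thesis using False by simp
  qed
  have eq: "i = j \<longleftrightarrow> a = b \<and> i mod n = j mod n"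
    unfolding a_def b_def by (metis div_mult_mod_eq)
  have "bcirc (t_id n n3) $$ (i, j) = (t_id n n3 ! k) $$ (i mod n, j mod n)"
    unfolding bcirc_def Let_def d index_mat(1)[OF ij] prod.case k_def a_def b_def ..
  also have "\<dots> = (if i = j then 1 else 0)"
    using k n unfolding eq k0[symmetric] by (simp add: t_id_def)
  finally show "bcirc (t_id n n3) $$ (i, j) = 1\<^sub>m (n * n3) $$ (i, j)" using ij by simp
qed

lemma t_pow_zero:
  assumes A: "A \<in> carrier_tensor n n n3" and n: "n > 0" and n3: "n3 > 0"
    and diagonalisable: "is_psd_mat_pow (bcirc A) 0 N"
  shows "A ^\<^sub>t 0 = t_id n n3"
proof -
  note d = carrier_tensorD(1)[OF A] carrier_tensorD(3,4)[OF A n3]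
  have m: "dim_row (bcirc A) = n * n3" by (simp add: bcirc_def Let_def d)
  have one: "M = 1\<^sub>m (n * n3)" if "is_psd_mat_pow (bcirc A) 0 M" for M
    using that unfolding is_psd_mat_pow_def m Let_def nonneg_pow_def
    by auto
  have "psd_mat_pow (bcirc A) 0 = 1\<^sub>m (n * n3)"
    unfolding psd_mat_pow_def using one diagonalisable by blast
  then have "A ^\<^sub>t 0 = (THE C. C \<in> carrier_tensor n n n3 \<and> bcirc C = 1\<^sub>m (n * n3))"
    by (simp only: t_pow_def d)
  also have "\<dots> = t_id n n3"
  proof (rule the_equality)
    show "t_id n n3 \<in> carrier_tensor n n n3 \<and> bcirc (t_id n n3) = 1\<^sub>m (n * n3)"
      using t_id_carrier bcirc_t_id[OF n n3] by blast
    show "C = t_id n n3" if "C \<in> carrier_tensor n n n3 \<and> bcirc C = 1\<^sub>m (n * n3)" for C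
      using bcirc_inj[OF _ t_id_carrier n3, of C] that bcirc_t_id[OF n n3] by metis
  qed
  finally show ?thesis .
qed

end

theory Submission
  imports Defs "Jordan_Normal_Form.Spectral_Radius"
begin

text \<open>
  The map \<open>bcirc\<close> embeds the tensors into the square matrices of size \<open>n * n3\<close>, and it carries
  every notion in the claim to its matrix counterpart: the t-product to the matrix product
  (\<open>t_prod_carrier_bcirc\<close>), t-positive semidefiniteness and the order to their quadratic-form versions
  (\<open>t_psd_iff\<close>, \<open>t_ge_iff\<close>), and tensor powers to matrix powers (\<open>t_pow_carrier_bcirc\<close>). Products and
  powers of tensors correspond to those of matrices because the block circulant matrices are exactly
  those that commute with a cyclic shift of the blocks, a property that matrix products and spectral
  powers inherit. Hence the claim is the Furuta inequality for real positive semidefinite matrices (\<open>furuta_psd\<close>).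

  For positive definite matrices the Furuta inequality rests on the Loewner-Heinz inequality
  (\<open>loewner_heinz_pd\<close>): \<open>B \<preceq> A\<close> implies \<open>B\<^sup>s \<preceq> A\<^sup>s\<close> for \<open>0 \<le> s \<le> 1\<close>. The set of exponents \<open>s\<close> that
  preserve the order contains 0 and 1, is closed, and is stable under midpoints by an eigenvector
  argument in the manner of Pedersen, so it contains the unit interval. Any spectral power \<open>f\<close>
  satisfies \<open>f (T * T\<^sup>T) * T = T * f (T\<^sup>T * T)\<close>; applied to \<open>T = B\<^sup>r * A\<^sup>p\<^sup>/\<^sup>2\<close> this turns the power of
  \<open>B\<^sup>r * A\<^sup>p * B\<^sup>r\<close> into a congruence of a negative power, to which Loewner-Heinz applies as long as
  \<open>2 * r \<le> 1\<close> (\<open>furuta_base\<close>). Applying that case to the resulting pair of matrices replaces \<open>r\<close> by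
  \<open>2 * r + 1/2\<close>, which reaches every \<open>r\<close> (\<open>furuta_critical\<close>). For \<open>p \<ge> 1\<close> this settles the
  least \<open>q\<close> that the hypothesis allows, and larger \<open>q\<close> follow by Loewner-Heinz; for \<open>p \<le> 1\<close>
  Loewner-Heinz alone suffices. The second inequality is the first one for the
  inverses, \<open>A\<^sup>-\<^sup>1 \<preceq> B\<^sup>-\<^sup>1\<close>.

  Singular matrices are approximated by \<open>A + e * I\<close> and \<open>B + e * I\<close>. The only delicate limit is that
  of the outer power \<open>1/q\<close>, whose base changes its eigenvectors along with \<open>e\<close>; since \<open>1/q \<le> 1\<close>,
  Loewner-Heinz itself bounds the change (\<open>pow_stability\<close>).
\<close>

section \<open>The spectral theorem for real symmetric matrices\<close>

text \<open>
  Over the complex numbers the matrix has an eigenvector \<open>x + \<i> y\<close>. Symmetry makes its eigenvalue real, so that \<open>x\<close>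
  and \<open>y\<close> satisfy the eigenvector equation themselves, and one of them is nonzero.
\<close>

lemma real_symmetric_eigenvector:
  fixes M :: "real mat"
  assumes M: "M \<in> carrier_mat m m" and sym: "M\<^sup>T = M" and m: "m > 0"
  obtains v e where "v \<in> carrier_vec m" "v \<bullet> v = 1" "M *\<^sub>v v = e \<cdot>\<^sub>v v"
proof -
  let ?C = "map_mat complex_of_real M"
  have C: "?C \<in> carrier_mat m m" using M by simp
  from spectrum_non_empty[OF C m] obtain k where "eigenvalue ?C k"
    by (auto simp: spectrum_def)
  then obtain z where z: "z \<in> carrier_vec m" "z \<noteq> 0\<^sub>v m" "?C *\<^sub>v z = k \<cdot>\<^sub>v z"
    using M by (auto simp: eigenvalue_def eigenvector_def)
  define x y where "x = map_vec Re z" and "y = map_vec Im z"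
  have x: "x \<in> carrier_vec m" and y: "y \<in> carrier_vec m" using z by (simp_all add: x_def y_def)
  have entry: "(\<Sum>j<m. complex_of_real (M $$ (i, j)) * z $ j) = k * z $ i" if "i < m" for i
    using arg_cong[OF z(3), of "\<lambda>w. w $ i"] that z(1) M
    by (simp add: scalar_prod_def atLeast0LessThan)
  have Mx: "M *\<^sub>v x = Re k \<cdot>\<^sub>v x - Im k \<cdot>\<^sub>v y"
  proof (rule eq_vecI)
    fix i assume "i < dim_vec (Re k \<cdot>\<^sub>v x - Im k \<cdot>\<^sub>v y)"
    then have i: "i < m" using y by simp
    show "(M *\<^sub>v x) $ i = (Re k \<cdot>\<^sub>v x - Im k \<cdot>\<^sub>v y) $ i"
      using arg_cong[OF entry[OF i], of Re] i z(1) M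
      by (simp add: scalar_prod_def atLeast0LessThan x_def y_def)
  qed (use M y in auto)
  have My: "M *\<^sub>v y = Im k \<cdot>\<^sub>v x + Re k \<cdot>\<^sub>v y"
  proof (rule eq_vecI)
    fix i assume "i < dim_vec (Im k \<cdot>\<^sub>v x + Re k \<cdot>\<^sub>v y)"
    then have i: "i < m" using y by simp
    show "(M *\<^sub>v y) $ i = (Im k \<cdot>\<^sub>v x + Re k \<cdot>\<^sub>v y) $ i"
      using arg_cong[OF entry[OF i], of Im] i z(1) M
      by (simp add: scalar_prod_def atLeast0LessThan x_def y_def)
  qed (use M y in auto)
  have pos: "w \<bullet> w > 0" if "w \<in> carrier_vec m" "w \<noteq> 0\<^sub>v m" for w :: "real vec"
    using conjugate_square_greater_0_vec[OF that(1)] that by simp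
  have nonneg: "w \<bullet> w \<ge> 0" if "w \<in> carrier_vec m" for w :: "real vec"
    using pos[OF that] by (cases "w = 0\<^sub>v m") auto
  have ne: "x \<noteq> 0\<^sub>v m \<or> y \<noteq> 0\<^sub>v m"
  proof (rule ccontr)
    assume "\<not> ?thesis"
    then have "z $ i = 0" if "i < m" for i
      using that z(1) by (metis carrier_vecD complex_eqI index_map_vec(1) index_zero_vec(1)
          x_def y_def zero_complex.simps)
    then show False using z by (auto intro: eq_vecI)
  qed
  \<comment> \<open>Symmetry forces the imaginary part of the eigenvalue to vanish.\<close>
  have "y \<bullet> (M *\<^sub>v x) = (M *\<^sub>v y) \<bullet> x"
    using transpose_vec_mult_scalar[OF M x y] sym by simp
  then have "Im k * (x \<bullet> x + y \<bullet> y) = 0"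
    using x y comm_scalar_prod[OF x y] unfolding Mx My
    by (simp add: scalar_prod_minus_distrib[of _ m] add_scalar_prod_distrib[of _ m] algebra_simps)
  then have k: "Im k = 0" using pos[OF x] pos[OF y] ne nonneg[OF x] nonneg[OF y] by fastforce
  obtain w where w: "w \<in> carrier_vec m" "w \<noteq> 0\<^sub>v m" "M *\<^sub>v w = Re k \<cdot>\<^sub>v w"
  proof (cases "x = 0\<^sub>v m")
    case True
    have "M *\<^sub>v y = Re k \<cdot>\<^sub>v y" unfolding My k using x y by auto
    then show ?thesis using that[of y] y ne True by blast
  next
    case False
    have "M *\<^sub>v x = Re k \<cdot>\<^sub>v x" unfolding Mx k using x y by auto
    then show ?thesis using that[of x] x False by blast
  qed
  define c where "c = 1 / sqrt (w \<bullet> w)"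
  have cc: "c * c * (w \<bullet> w) = 1" using pos[OF w(1,2)] by (simp add: c_def)
  show thesis
  proof
    show "c \<cdot>\<^sub>v w \<in> carrier_vec m" using w by simp
    show "(c \<cdot>\<^sub>v w) \<bullet> (c \<cdot>\<^sub>v w) = 1" using w cc by simp
    show "M *\<^sub>v (c \<cdot>\<^sub>v w) = Re k \<cdot>\<^sub>v (c \<cdot>\<^sub>v w)"
      using M w by (simp add: mult_mat_vec smult_smult_assoc mult.commute)
  qed
qed

text \<open>
  The Householder reflection that exchanges the first unit vector and \<open>v\<close>.
\<close>

lemma orthogonal_matrix_with_first_column:
  fixes v :: "real vec"
  assumes v: "v \<in> carrier_vec m" and unit: "v \<bullet> v = 1" and m: "m > 0"
  obtains H where "H \<in> carrier_mat m m" "H\<^sup>T = H" "H * H = 1\<^sub>m m" "col H 0 = v"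
proof (cases "v = unit_vec m 0")
  case True
  then show thesis using that[of "1\<^sub>m m"] m by simp
next
  case False
  define u where "u = v - unit_vec m 0"
  have u: "u \<in> carrier_vec m" using v by (simp add: u_def)
  have u0: "u \<noteq> 0\<^sub>v m"
  proof
    assume 0: "u = 0\<^sub>v m"
    have "v = unit_vec m 0"
    proof (rule eq_vecI)
      fix i assume "i < dim_vec (unit_vec m 0 :: real vec)"
      then show "v $ i = unit_vec m 0 $ i"
        using arg_cong[OF 0, of "\<lambda>w. w $ i"] v by (simp add: u_def)
    qed (use v in auto)
    with False show False ..
  qed
  have uu: "u \<bullet> u = 2 - 2 * v $ 0"
    using v unit m unfolding u_def
    by (simp add: minus_scalar_prod_distrib[of _ m] scalar_prod_minus_distrib[of _ m]
        scalar_prod_right_unit scalar_prod_left_unit)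
  have pos: "u \<bullet> u > 0" using conjugate_square_greater_0_vec[OF u] u0 by simp
  define c where "c = 2 / (u \<bullet> u)"
  have cc: "c * (u \<bullet> u) = 2" using pos by (simp add: c_def)
  \<comment> \<open>The reflection \<open>1 - c u u\<^sup>T\<close> in the hyperplane orthogonal to \<open>u\<close>.\<close>
  define H where "H = mat m m (\<lambda>(i, j). (if i = j then 1 else 0) - c * (u $ i * u $ j))"
  have H: "H \<in> carrier_mat m m" by (simp add: H_def)
  show thesis
  proof
    show "H \<in> carrier_mat m m" by (rule H)
    show "H\<^sup>T = H" by (rule eq_matI) (auto simp: H_def mult.commute)
    show "H * H = 1\<^sub>m m"
    proof (rule eq_matI)
      fix i j assume "i < dim_row (1\<^sub>m m)" "j < dim_col (1\<^sub>m m)"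
      then have ij: "i < m" "j < m" by simp_all
      have "(H * H) $$ (i, j) = (\<Sum>k<m. H $$ (i, k) * H $$ (k, j))"
        using H ij by (simp add: scalar_prod_def atLeast0LessThan)
      also have "\<dots> = (\<Sum>k<m. (if i = k then (if k = j then 1 else 0) else 0)
          - (if i = k then c * (u $ k * u $ j) else 0) - (if k = j then c * (u $ i * u $ k) else 0)
          + c * u $ i * u $ j * (c * (u $ k * u $ k)))"
        using ij by (intro sum.cong) (auto simp: H_def algebra_simps)
      also have "\<dots> = (if i = j then 1 else 0) - 2 * c * u $ i * u $ j
          + c * u $ i * u $ j * (c * (u \<bullet> u))"
        using ij u
        by (simp add: sum.distrib sum_subtractf scalar_prod_def atLeast0LessThan
            sum_distrib_left[symmetric])
      also have "\<dots> = 1\<^sub>m m $$ (i, j)" using ij by (simp add: cc)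
      finally show "(H * H) $$ (i, j) = 1\<^sub>m m $$ (i, j)" .
    qed (use H in auto)
    show "col H 0 = v"
    proof (rule eq_vecI)
      fix i assume "i < dim_vec v"
      then have i: "i < m" using v by simp
      have "c * u $ 0 = -1"
        using cc v m unfolding uu by (simp add: u_def algebra_simps)
      then have "c * (u $ i * u $ 0) = - u $ i"
        by (metis mult.left_commute mult_minus1_right)
      then show "col H 0 $ i = v $ i" using i m v by (simp add: H_def u_def)
    qed (use H v in auto)
  qed
qed

text \<open>
  Deflation: conjugating with a reflection that sends the first unit vector to an eigenvector splits
  off a block of size one, and the induction hypothesis diagonalises the rest.
\<close>

theorem real_spectral_theorem:
  fixes M :: "real mat"
  assumes "M \<in> carrier_mat m m" and "M\<^sup>T = M"
  shows "\<exists>Q d. Q \<in> carrier_mat m m \<and> Q\<^sup>T * Q = 1\<^sub>m m \<and> Q * Q\<^sup>T = 1\<^sub>m m \<and>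
           M = Q * mat_diag m d * Q\<^sup>T"
  using assms
proof (induction m arbitrary: M)
  case 0
  then show ?case by (intro exI[of _ "1\<^sub>m 0"] exI[of _ "\<lambda>_. 0"]) auto
next
  case (Suc m)
  note M = Suc.prems(1) and sym = Suc.prems(2)
  obtain v e where v: "v \<in> carrier_vec (Suc m)" "v \<bullet> v = 1" "M *\<^sub>v v = e \<cdot>\<^sub>v v"
    using real_symmetric_eigenvector[OF M sym] by auto
  obtain H where H: "H \<in> carrier_mat (Suc m) (Suc m)" "H\<^sup>T = H" "H * H = 1\<^sub>m (Suc m)" "col H 0 = v"
    using orthogonal_matrix_with_first_column[OF v(1,2)] by auto
  define K where "K = H * M * H"
  have K: "K \<in> carrier_mat (Suc m) (Suc m)" using H M by (simp add: K_def)
  have Ksym: "K\<^sup>T = K" using H M sym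
    by (simp add: K_def transpose_mult[of _ "Suc m" "Suc m" _ "Suc m"]
        assoc_mult_mat[of _ "Suc m" "Suc m" _ "Suc m" _ "Suc m"])
  have colK: "col K 0 = e \<cdot>\<^sub>v col (1\<^sub>m (Suc m)) 0"
  proof -
    have "col K 0 = H *\<^sub>v (M *\<^sub>v v)"
      using H M col_mult2[of H "Suc m" "Suc m" "M * H" "Suc m" 0]
        col_mult2[of M "Suc m" "Suc m" H "Suc m" 0]
      by (simp add: K_def assoc_mult_mat[of _ "Suc m" "Suc m" _ "Suc m" _ "Suc m"]
          del: col_mult2)
    also have "\<dots> = e \<cdot>\<^sub>v (H *\<^sub>v col H 0)" using H v by (simp add: mult_mat_vec)
    also have "H *\<^sub>v col H 0 = col (1\<^sub>m (Suc m)) 0"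
      using H col_mult2[of H "Suc m" "Suc m" H "Suc m" 0] by simp
    finally show ?thesis .
  qed
  have K0: "K $$ (i, 0) = (if i = 0 then e else 0)" if "i < Suc m" for i
  proof -
    have "K $$ (i, 0) = col K 0 $ i" using that K by simp
    also have "\<dots> = (if i = 0 then e else 0)" unfolding colK using that by simp
    finally show ?thesis .
  qed
  have K0': "K $$ (0, i) = (if i = 0 then e else 0)" if "i < Suc m" for i
    using K0[OF that] arg_cong[OF Ksym, of "\<lambda>X. X $$ (i, 0)"] that K by simp
  define N where "N = mat m m (\<lambda>(i, j). K $$ (Suc i, Suc j))"
  have N: "N \<in> carrier_mat m m" by (simp add: N_def)
  have "K $$ (j, i) = K $$ (i, j)" if "i < Suc m" "j < Suc m" for i j
    using arg_cong[OF Ksym, of "\<lambda>X. X $$ (i, j)"] that K by simp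
  then have "N\<^sup>T = N" by (intro eq_matI) (auto simp: N_def)
  from Suc.IH[OF N this] obtain Q d where Q: "Q \<in> carrier_mat m m" "Q\<^sup>T * Q = 1\<^sub>m m"
    "Q * Q\<^sup>T = 1\<^sub>m m" "N = Q * mat_diag m d * Q\<^sup>T" by blast
  define blk :: "real \<Rightarrow> real mat \<Rightarrow> real mat" where
    "blk a X = four_block_mat (mat 1 1 (\<lambda>_. a)) (0\<^sub>m 1 m) (0\<^sub>m m 1) X" for a X
  have blk: "blk a X \<in> carrier_mat (Suc m) (Suc m)" if "X \<in> carrier_mat m m" for a X
    unfolding blk_def using that four_block_carrier_mat[of "mat 1 1 (\<lambda>_. a)" 1 1 X m m] by simp
  have blk_mult: "blk a X * blk b Y = blk (a * b) (X * Y)"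
    if "X \<in> carrier_mat m m" "Y \<in> carrier_mat m m" for a b X Y
  proof -
    have "mat 1 1 (\<lambda>_. a) * mat 1 1 (\<lambda>_. b) + 0\<^sub>m 1 m * 0\<^sub>m m 1 = mat 1 1 (\<lambda>_. a * b)"
      by (rule eq_matI) (auto simp: scalar_prod_def)
    then show ?thesis unfolding blk_def using that
      by (subst mult_four_block_mat[of _ 1 1 _ m _ m _ _ 1 _ m]) auto
  qed
  have blk_transpose: "(blk a X)\<^sup>T = blk a X\<^sup>T" if "X \<in> carrier_mat m m" for a X
  proof -
    have "(mat 1 1 (\<lambda>_. a))\<^sup>T = mat 1 1 (\<lambda>_. a)" by (rule eq_matI) auto
    then show ?thesis unfolding blk_def using that
      by (subst transpose_four_block_mat[of _ 1 1 _ m _ m]) auto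
  qed
  have blk_one: "blk 1 (1\<^sub>m m) = 1\<^sub>m (Suc m)" by (rule eq_matI) (auto simp: blk_def)
  have blk_K: "K = blk e N"
    using K K0 K0' by (intro eq_matI) (auto simp: N_def blk_def)
  have blk_diag: "blk e (mat_diag m d) = mat_diag (Suc m) (\<lambda>i. if i = 0 then e else d (i - 1))"
    by (rule eq_matI) (auto simp: mat_diag_def blk_def)
  define R where "R = H * blk 1 Q"
  have B: "blk 1 Q \<in> carrier_mat (Suc m) (Suc m)" using blk[OF Q(1)] .
  have BT: "(blk 1 Q)\<^sup>T \<in> carrier_mat (Suc m) (Suc m)" using B by simp
  have BB: "blk 1 Q * (blk 1 Q)\<^sup>T = 1\<^sub>m (Suc m)" "(blk 1 Q)\<^sup>T * blk 1 Q = 1\<^sub>m (Suc m)"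
    using Q by (simp_all add: blk_transpose blk_mult blk_one)
  have R: "R \<in> carrier_mat (Suc m) (Suc m)" using H B by (simp add: R_def)
  note asc = assoc_mult_mat[of _ "Suc m" "Suc m" _ "Suc m" _ "Suc m"]
  have RT: "R\<^sup>T = (blk 1 Q)\<^sup>T * H"
    using H B by (simp add: R_def transpose_mult[of _ "Suc m" "Suc m" _ "Suc m"])
  have "R\<^sup>T * R = (blk 1 Q)\<^sup>T * (H * H) * blk 1 Q"
    unfolding RT unfolding R_def using H(1) B BT by (simp add: asc)
  then have 1: "R\<^sup>T * R = 1\<^sub>m (Suc m)" using H BB BT by simp
  have "R * R\<^sup>T = H * (blk 1 Q * (blk 1 Q)\<^sup>T) * H"
    unfolding RT unfolding R_def using H(1) B BT by (simp add: asc)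
  then have 2: "R * R\<^sup>T = 1\<^sub>m (Suc m)" using H BB by simp
  let ?D = "mat_diag (Suc m) (\<lambda>i. if i = 0 then e else d (i - 1))"
  have D: "?D \<in> carrier_mat (Suc m) (Suc m)" by simp
  have "K = blk 1 Q * ?D * (blk 1 Q)\<^sup>T"
    unfolding blk_K Q(4) blk_diag[symmetric] blk_transpose[OF Q(1)]
    using Q(1) by (simp add: blk_mult)
  then have "R * ?D * R\<^sup>T = H * K * H"
    unfolding RT unfolding R_def using H(1) B BT D
    by (simp add: asc mult_carrier_mat[of _ "Suc m" "Suc m" _ "Suc m"])
  also have "\<dots> = (H * H) * M * (H * H)" using H(1) M by (simp add: K_def asc)
  also have "\<dots> = M" using H(3) M by simp
  finally show ?case using R 1 2 by metis
qed

section \<open>Spectral calculus and the Loewner order\<close>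

abbreviation qform :: "real mat \<Rightarrow> real vec \<Rightarrow> real" where
  "qform M x \<equiv> x \<bullet> (M *\<^sub>v x)"

lemma mat_mult_mat_diag_index:
  fixes A :: "real mat"
  assumes "A \<in> carrier_mat m m" "i < m" "j < m"
  shows "(mat_diag m d * A) $$ (i, j) = d i * A $$ (i, j)"
    and "(A * mat_diag m d) $$ (i, j) = A $$ (i, j) * d j"
  using assms by (simp_all add: mat_diag_mult_left[of _ m m] mat_diag_mult_right[of _ m m])

text \<open>
  With one fixed size, membership in \<open>sq\<close> supplies all the dimensions that the matrix laws ask for, so
  that rewriting with them needs no instantiation.
\<close>

locale fixed_dim =
  fixes m :: nat
begin

abbreviation "sq \<equiv> carrier_mat m m :: real mat set"
abbreviation "vs \<equiv> carrier_vec m :: real vec set"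

lemma sq_mult [simp]: "A \<in> sq \<Longrightarrow> B \<in> sq \<Longrightarrow> A * B \<in> sq" by simp
lemma sq_mult_vec [simp]: "A \<in> sq \<Longrightarrow> x \<in> vs \<Longrightarrow> A *\<^sub>v x \<in> vs" by simp

lemma sq_assoc: "A \<in> sq \<Longrightarrow> B \<in> sq \<Longrightarrow> C \<in> sq \<Longrightarrow> A * B * C = A * (B * C)"
  by (rule assoc_mult_mat)

lemma sq_assoc_vec: "A \<in> sq \<Longrightarrow> B \<in> sq \<Longrightarrow> x \<in> vs \<Longrightarrow> (A * B) *\<^sub>v x = A *\<^sub>v (B *\<^sub>v x)"
  by (rule assoc_mult_mat_vec)

lemma sq_transpose_mult: "A \<in> sq \<Longrightarrow> B \<in> sq \<Longrightarrow> (A * B)\<^sup>T = B\<^sup>T * A\<^sup>T"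
  by (rule transpose_mult)

lemma sq_adjoint: "A \<in> sq \<Longrightarrow> x \<in> vs \<Longrightarrow> y \<in> vs \<Longrightarrow> x \<bullet> (A *\<^sub>v y) = (A\<^sup>T *\<^sub>v x) \<bullet> y"
  using transpose_vec_mult_scalar[of A m m y x] by simp

lemma mat_diag_transpose [simp]: "(mat_diag m d)\<^sup>T = mat_diag m d"
  by (rule eq_matI) (auto simp: mat_diag_def)

lemma mat_diag_cong: "(\<And>i. i < m \<Longrightarrow> f i = g i) \<Longrightarrow> mat_diag m f = mat_diag m g"
  by (rule eq_matI) (auto simp: mat_diag_def)

definition symm :: "real mat \<Rightarrow> bool" where
  "symm M \<longleftrightarrow> M \<in> sq \<and> M\<^sup>T = M"

definition psd :: "real mat \<Rightarrow> bool" where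
  "psd M \<longleftrightarrow> symm M \<and> (\<forall>x \<in> vs. 0 \<le> qform M x)"

definition pd :: "real mat \<Rightarrow> bool" where
  "pd M \<longleftrightarrow> symm M \<and> (\<forall>x \<in> vs. x \<noteq> 0\<^sub>v m \<longrightarrow> 0 < qform M x)"

definition loewner_le :: "real mat \<Rightarrow> real mat \<Rightarrow> bool" (infix "\<preceq>" 50) where
  "M \<preceq> N \<longleftrightarrow> (\<forall>x \<in> vs. qform M x \<le> qform N x)"

lemma loewner_leD: "M \<preceq> N \<Longrightarrow> x \<in> vs \<Longrightarrow> qform M x \<le> qform N x"
  by (simp add: loewner_le_def)

lemma loewner_le_trans [trans]: "L \<preceq> M \<Longrightarrow> M \<preceq> N \<Longrightarrow> L \<preceq> N"
  unfolding loewner_le_def by (meson order_trans)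

lemma loewner_le_refl: "M \<preceq> M"
  by (simp add: loewner_le_def)

lemma symmD: "symm M \<Longrightarrow> M \<in> sq" "symm M \<Longrightarrow> M\<^sup>T = M"
  by (simp_all add: symm_def)

lemma psdD: "psd M \<Longrightarrow> symm M" "psd M \<Longrightarrow> x \<in> vs \<Longrightarrow> 0 \<le> qform M x"
  by (simp_all add: psd_def)

lemma pdD: "pd M \<Longrightarrow> symm M" "pd M \<Longrightarrow> x \<in> vs \<Longrightarrow> x \<noteq> 0\<^sub>v m \<Longrightarrow> 0 < qform M x"
  by (simp_all add: pd_def)

lemma pd_imp_psd: "pd M \<Longrightarrow> psd M"
  unfolding pd_def psd_def symm_def
proof safe
  fix x assume "\<forall>x\<in>vs. x \<noteq> 0\<^sub>v m \<longrightarrow> 0 < qform M x" "M \<in> sq" "x \<in> vs"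
  then show "0 \<le> qform M x" by (cases "x = 0\<^sub>v m") (auto intro: less_imp_le)
qed

lemma symm_sq [simp]: "symm M \<Longrightarrow> M \<in> sq" by (rule symmD)
lemma psd_sq [simp]: "psd M \<Longrightarrow> M \<in> sq" by (simp add: psdD)
lemma pd_sq [simp]: "pd M \<Longrightarrow> M \<in> sq" by (simp add: pdD)

lemma symm_swap: "symm M \<Longrightarrow> x \<in> vs \<Longrightarrow> y \<in> vs \<Longrightarrow> x \<bullet> (M *\<^sub>v y) = (M *\<^sub>v x) \<bullet> y"
  by (simp add: sq_adjoint symmD)

lemma qform_congruence:
  assumes "T \<in> sq" "M \<in> sq" "x \<in> vs"
  shows "qform (T\<^sup>T * M * T) x = qform M (T *\<^sub>v x)"
proof -
  have "qform (T\<^sup>T * M * T) x = x \<bullet> (T\<^sup>T *\<^sub>v (M *\<^sub>v (T *\<^sub>v x)))"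
    using assms by (simp add: sq_assoc_vec)
  also have "\<dots> = (T\<^sup>T\<^sup>T *\<^sub>v x) \<bullet> (M *\<^sub>v (T *\<^sub>v x))"
    by (rule sq_adjoint) (use assms in simp_all)
  finally show ?thesis by simp
qed

lemma loewner_le_congruence:
  assumes "T \<in> sq" "M \<in> sq" "N \<in> sq" "M \<preceq> N"
  shows "T\<^sup>T * M * T \<preceq> T\<^sup>T * N * T"
  using assms by (simp add: loewner_le_def qform_congruence del: assoc_mult_mat)

lemma symm_congruence: "T \<in> sq \<Longrightarrow> symm M \<Longrightarrow> symm (T\<^sup>T * M * T)"
  by (simp add: symm_def sq_transpose_mult sq_assoc)

lemma psd_congruence: "T \<in> sq \<Longrightarrow> psd M \<Longrightarrow> psd (T\<^sup>T * M * T)"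
  by (simp add: psd_def symm_congruence qform_congruence del: assoc_mult_mat)

definition diagonalises :: "real mat \<Rightarrow> (nat \<Rightarrow> real) \<Rightarrow> real mat \<Rightarrow> bool" where
  "diagonalises Q d M \<longleftrightarrow> Q \<in> sq \<and> Q\<^sup>T * Q = 1\<^sub>m m \<and> Q * Q\<^sup>T = 1\<^sub>m m \<and>
     M = Q * mat_diag m d * Q\<^sup>T"

lemma symm_diagonalisable: "symm M \<Longrightarrow> \<exists>Q d. diagonalises Q d M"
  using real_spectral_theorem[of M m] by (auto simp: symm_def diagonalises_def)

definition spectral :: "real mat \<Rightarrow> (nat \<Rightarrow> real) \<Rightarrow> real mat" where
  "spectral Q d = Q * mat_diag m d * Q\<^sup>T"

lemma diagonalisesD:
  assumes "diagonalises Q d M"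
  shows "Q \<in> sq" "Q\<^sup>T * Q = 1\<^sub>m m" "Q * Q\<^sup>T = 1\<^sub>m m" "M = spectral Q d"
    "\<And>X. X \<in> sq \<Longrightarrow> Q\<^sup>T * (Q * X) = X" "\<And>X. X \<in> sq \<Longrightarrow> Q * (Q\<^sup>T * X) = X"
proof -
  show *: "Q \<in> sq" "Q\<^sup>T * Q = 1\<^sub>m m" "Q * Q\<^sup>T = 1\<^sub>m m" "M = spectral Q d"
    using assms by (auto simp: diagonalises_def spectral_def)
  show "Q\<^sup>T * (Q * X) = X" "Q * (Q\<^sup>T * X) = X" if "X \<in> sq" for X
    using that * sq_assoc[of "Q\<^sup>T" Q X] sq_assoc[of Q "Q\<^sup>T" X] by simp_all
qed

lemma diagonalises_spectral: "diagonalises Q d M \<Longrightarrow> diagonalises Q f (spectral Q f)"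
  by (simp add: diagonalises_def spectral_def)

lemma symm_spectral: "Q \<in> sq \<Longrightarrow> symm (spectral Q f)"
  by (simp add: symm_def spectral_def sq_transpose_mult sq_assoc)

lemma spectral_sq [simp]: "Q \<in> sq \<Longrightarrow> spectral Q f \<in> sq"
  by (simp add: spectral_def)

lemma spectral_cong: "(\<And>i. i < m \<Longrightarrow> f i = g i) \<Longrightarrow> spectral Q f = spectral Q g"
  using mat_diag_cong[of f g] by (simp add: spectral_def)

lemma spectral_mult:
  assumes "diagonalises Q d M"
  shows "spectral Q f * spectral Q g = spectral Q (\<lambda>i. f i * g i)"
proof -
  note D = diagonalisesD[OF assms]
  have "spectral Q f * spectral Q g = Q * (mat_diag m f * (mat_diag m g * Q\<^sup>T))"
    using D by (simp add: spectral_def sq_assoc)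
  also have "\<dots> = Q * (mat_diag m f * mat_diag m g * Q\<^sup>T)"
    using D(1) by (simp add: sq_assoc del: mat_diag_diag)
  finally show ?thesis using D(1) by (simp add: spectral_def sq_assoc)
qed

lemma spectral_one: "diagonalises Q d M \<Longrightarrow> spectral Q (\<lambda>_. 1) = 1\<^sub>m m"
  using diagonalisesD[of Q d M] by (simp add: spectral_def)

text \<open>
  The central tool. In eigenbases of \<open>M\<close> and \<open>N\<close> the relation \<open>M * T = T * N\<close> says that an entry of
  \<open>T\<close> can be nonzero only where the eigenvalues agree, and there \<open>f\<close> agrees too. With \<open>T = 1\<close> this
  shows that spectral powers are well defined, with a shift matrix that they stay block circulant, and
  with \<open>M = T * T\<^sup>T\<close>, \<open>N = T\<^sup>T * T\<close> it is the identity behind the Furuta inequality.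
\<close>

lemma spectral_intertwine:
  assumes 1: "diagonalises Q d M" and 2: "diagonalises R e N" and T: "T \<in> sq"
    and MT: "M * T = T * N"
  shows "spectral Q (\<lambda>i. f (d i)) * T = T * spectral R (\<lambda>i. f (e i))"
proof -
  note D = diagonalisesD[OF 1] and E = diagonalisesD[OF 2]
  define S where "S = Q\<^sup>T * T * R"
  have S: "S \<in> sq" using D(1) E(1) T by (simp add: S_def)
  have T_eq: "T = Q * (S * R\<^sup>T)" using D E T by (simp add: S_def sq_assoc)
  have move: "spectral Q g * T = Q * (mat_diag m g * S) * R\<^sup>T"
    "T * spectral R h = Q * (S * mat_diag m h) * R\<^sup>T" for g h
    using D E(1,2,5) S unfolding T_eq by (simp_all add: spectral_def sq_assoc)
  have cancel: "Q\<^sup>T * (Q * X * R\<^sup>T) * R = X" if "X \<in> sq" for X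
    using D E that by (simp add: sq_assoc)
  have "Q * (mat_diag m d * S) * R\<^sup>T = Q * (S * mat_diag m e) * R\<^sup>T"
    using MT unfolding D(4) E(4) move .
  then have "mat_diag m d * S = S * mat_diag m e"
    using cancel[of "mat_diag m d * S"] cancel[of "S * mat_diag m e"] S
    by (metis mat_diag_dim sq_mult)
  then have ev: "d i * S $$ (i, j) = S $$ (i, j) * e j" if "i < m" "j < m" for i j
    using mat_mult_mat_diag_index(1)[OF S that, of d] mat_mult_mat_diag_index(2)[OF S that, of e]
    by metis
  have "f (d i) * S $$ (i, j) = S $$ (i, j) * f (e j)" if "i < m" "j < m" for i j
    using ev[OF that] by (cases "S $$ (i, j) = 0") (auto simp: mult.commute)
  then have "mat_diag m (\<lambda>i. f (d i)) * S = S * mat_diag m (\<lambda>i. f (e i))"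
    using carrier_matD[OF S] mat_mult_mat_diag_index[OF S]
    by (intro eq_matI) (auto simp: mat_diag_def simp del: index_mult_mat(1))
  then show ?thesis unfolding move by simp
qed

lemma qform_mat_diag:
  assumes y: "y \<in> vs"
  shows "qform (mat_diag m f) y = (\<Sum>i<m. f i * (y $ i)\<^sup>2)"
proof -
  have "(mat_diag m f *\<^sub>v y) $ i = f i * y $ i" if "i < m" for i
  proof -
    have "(mat_diag m f *\<^sub>v y) $ i = (\<Sum>j<m. (if i = j then f j else 0) * y $ j)"
      using that y by (simp add: mat_diag_def scalar_prod_def atLeast0LessThan)
    also have "\<dots> = (\<Sum>j<m. if i = j then f j * y $ j else 0)" by (intro sum.cong) auto
    finally show ?thesis using that by simp
  qed
  moreover have "qform (mat_diag m f) y = (\<Sum>i<m. y $ i * (mat_diag m f *\<^sub>v y) $ i)"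
    using carrier_matD(1)[OF mat_diag_dim[of m f]]
    by (simp only: scalar_prod_def dim_mult_mat_vec atLeast0LessThan)
  ultimately show ?thesis by (simp add: power2_eq_square mult.left_commute)
qed

lemma qform_spectral:
  assumes "Q \<in> sq" "x \<in> vs"
  shows "qform (spectral Q f) x = (\<Sum>i<m. f i * ((Q\<^sup>T *\<^sub>v x) $ i)\<^sup>2)"
proof -
  have "spectral Q f = Q\<^sup>T\<^sup>T * mat_diag m f * Q\<^sup>T"
    by (simp add: spectral_def)
  moreover have "qform (Q\<^sup>T\<^sup>T * mat_diag m f * Q\<^sup>T) x = qform (mat_diag m f) (Q\<^sup>T *\<^sub>v x)"
    by (rule qform_congruence) (use assms in simp_all)
  moreover have "Q\<^sup>T *\<^sub>v x \<in> vs" using assms by simp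
  ultimately show ?thesis by (simp only: qform_mat_diag)
qed

lemma loewner_le_spectral:
  assumes "Q \<in> sq" "\<And>i. i < m \<Longrightarrow> f i \<le> g i"
  shows "spectral Q f \<preceq> spectral Q g"
  using assms by (auto simp: loewner_le_def qform_spectral intro!: sum_mono mult_right_mono)

lemma diagonalises_eigenvector:
  assumes "diagonalises Q d M" "i < m"
  obtains u where "u \<in> vs" "u \<noteq> 0\<^sub>v m" "M *\<^sub>v u = d i \<cdot>\<^sub>v u" "\<And>f. qform (spectral Q f) u = f i"
proof -
  note D = diagonalisesD[OF assms(1)]
  define u where "u = Q *\<^sub>v unit_vec m i"
  have u: "u \<in> vs" using D(1) by (simp add: u_def)
  have Qu: "Q\<^sup>T *\<^sub>v u = unit_vec m i"
    using D(1,2) sq_assoc_vec[of "Q\<^sup>T" Q "unit_vec m i"] by (simp add: u_def)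
  have q: "qform (spectral Q f) u = f i" for f
  proof -
    have "qform (spectral Q f) u = (\<Sum>j<m. if j = i then f i else 0)"
      unfolding qform_spectral[OF D(1) u] Qu using assms(2) by (intro sum.cong) auto
    then show ?thesis using assms(2) by simp
  qed
  have "mat_diag m d *\<^sub>v unit_vec m i = d i \<cdot>\<^sub>v unit_vec m i"
    using assms(2) by (intro eq_vecI) (auto simp: mat_diag_def)
  moreover have "M *\<^sub>v u = Q *\<^sub>v (mat_diag m d *\<^sub>v (Q\<^sup>T *\<^sub>v u))"
    using D(1) u unfolding D(4) by (simp add: spectral_def sq_assoc_vec)
  ultimately have Mu: "M *\<^sub>v u = d i \<cdot>\<^sub>v u"
    unfolding Qu using D(1) by (simp add: u_def mult_mat_vec[of _ m m])
  have uu: "u \<bullet> u = 1"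
    using q[of "\<lambda>_. 1"] u by (simp add: spectral_one[OF assms(1)])
  then have "u \<noteq> 0\<^sub>v m" by auto
  with that u Mu q show thesis by blast
qed

lemma psd_iff_eigenvalues:
  assumes "diagonalises Q d M"
  shows "psd M \<longleftrightarrow> (\<forall>i<m. 0 \<le> d i)"
proof
  note D = diagonalisesD[OF assms]
  show "\<forall>i<m. 0 \<le> d i" if "psd M"
  proof safe
    fix i assume "i < m"
    from diagonalises_eigenvector[OF assms this] that show "0 \<le> d i"
      unfolding D(4) psd_def by metis
  qed
  show "psd M" if "\<forall>i<m. 0 \<le> d i"
    using that D(1) unfolding D(4)
    by (auto simp: psd_def symm_spectral qform_spectral intro!: sum_nonneg)
qed

lemma pd_iff_eigenvalues:
  assumes "diagonalises Q d M"
  shows "pd M \<longleftrightarrow> (\<forall>i<m. 0 < d i)"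
proof
  note D = diagonalisesD[OF assms]
  show "\<forall>i<m. 0 < d i" if "pd M"
  proof safe
    fix i assume "i < m"
    from diagonalises_eigenvector[OF assms this] that show "0 < d i"
      unfolding D(4) pd_def by metis
  qed
  show "pd M" if pos: "\<forall>i<m. 0 < d i"
    unfolding pd_def
  proof safe
    show "symm M" using D(1) unfolding D(4) by (rule symm_spectral)
    fix x assume x: "x \<in> vs" "x \<noteq> 0\<^sub>v m"
    have "Q\<^sup>T *\<^sub>v x \<noteq> 0\<^sub>v m"
    proof
      assume "Q\<^sup>T *\<^sub>v x = 0\<^sub>v m"
      moreover have "x = Q *\<^sub>v (Q\<^sup>T *\<^sub>v x)"
        using sq_assoc_vec[of Q "Q\<^sup>T" x] D(1,3) x by simp
      ultimately show False using x D(1) by auto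
    qed
    then obtain i where i: "i < m" "(Q\<^sup>T *\<^sub>v x) $ i \<noteq> 0"
      using D(1) x by (metis carrier_matD(1) dim_mult_mat_vec eq_vecI index_zero_vec
          transpose_carrier_mat)
    have "0 < (\<Sum>j<m. d j * ((Q\<^sup>T *\<^sub>v x) $ j)\<^sup>2)"
      using pos i by (intro sum_pos2[of _ i]) (auto intro: less_imp_le)
    then show "0 < qform M x" unfolding D(4) by (simp add: qform_spectral[OF D(1) x(1)])
  qed
qed

lemma is_psd_mat_pow_iff:
  assumes "M \<in> sq"
  shows "is_psd_mat_pow M r N \<longleftrightarrow> (\<exists>Q d. diagonalises Q d M \<and> (\<forall>i<m. 0 \<le> d i) \<and>
           N = spectral Q (\<lambda>i. nonneg_pow (d i) r))"
  using assms by (auto simp: is_psd_mat_pow_def diagonalises_def spectral_def Let_def)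

text \<open>
  Any two diagonalisations give the same power, because the identity intertwines \<open>M\<close> with itself.
\<close>

lemma psd_mat_pow_spectral:
  assumes Q: "diagonalises Q d M" and "psd M"
  shows "psd_mat_pow M r = spectral Q (\<lambda>i. nonneg_pow (d i) r)"
  unfolding psd_mat_pow_def
proof (rule the_equality)
  have M: "M \<in> sq" and d: "\<forall>i<m. 0 \<le> d i"
    using assms psd_iff_eigenvalues by auto
  show "is_psd_mat_pow M r (spectral Q (\<lambda>i. nonneg_pow (d i) r))"
    using Q d is_psd_mat_pow_iff[OF M] by blast
  fix N assume "is_psd_mat_pow M r N"
  then obtain R e where R: "diagonalises R e M" "N = spectral R (\<lambda>i. nonneg_pow (e i) r)"
    using is_psd_mat_pow_iff[OF M] by blast
  have "N * 1\<^sub>m m = 1\<^sub>m m * spectral Q (\<lambda>i. nonneg_pow (d i) r)"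
    unfolding R(2) by (rule spectral_intertwine[OF R(1) Q, where f = "\<lambda>x. nonneg_pow x r"])
      (use M in simp_all)
  then show "N = spectral Q (\<lambda>i. nonneg_pow (d i) r)"
    using diagonalisesD(1)[OF Q] diagonalisesD(1)[OF R(1)] unfolding R(2)
    by (simp add: left_mult_one_mat[of _ m m] right_mult_one_mat[of _ m m])
qed

lemma psd_obtain_diagonalisation:
  assumes "psd M"
  obtains Q d where "diagonalises Q d M" "\<forall>i<m. 0 \<le> d i"
    "\<And>r. psd_mat_pow M r = spectral Q (\<lambda>i. nonneg_pow (d i) r)"
  using symm_diagonalisable[of M] psdD(1)[OF assms] psd_iff_eigenvalues psd_mat_pow_spectral assms
  by metis

text \<open>
  On positive eigenvalues \<open>nonneg_pow\<close> agrees with \<open>powr\<close> for every real exponent, so that the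
  positive definite matrices have negative powers as well.
\<close>

lemma pd_obtain_diagonalisation:
  assumes "pd M"
  obtains Q d where "diagonalises Q d M" "\<forall>i<m. 0 < d i"
    "\<And>r. psd_mat_pow M r = spectral Q (\<lambda>i. d i powr r)"
proof -
  obtain Q d where Q: "diagonalises Q d M"
    "\<And>r. psd_mat_pow M r = spectral Q (\<lambda>i. nonneg_pow (d i) r)"
    using psd_obtain_diagonalisation[OF pd_imp_psd[OF assms]] by metis
  have d: "\<forall>i<m. 0 < d i" using assms pd_iff_eigenvalues[OF Q(1)] by simp
  then have "spectral Q (\<lambda>i. nonneg_pow (d i) r) = spectral Q (\<lambda>i. d i powr r)" for r
    by (intro spectral_cong) (auto simp: nonneg_pow_def)
  with that Q d show thesis by simp
qed

lemma nonneg_pow_nonneg: "0 \<le> x \<Longrightarrow> 0 \<le> nonneg_pow x r"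
  by (simp add: nonneg_pow_def)

lemma psd_psd_mat_pow:
  assumes "psd M"
  shows "psd (psd_mat_pow M r)"
proof -
  obtain Q d where Q: "diagonalises Q d M" "\<forall>i<m. 0 \<le> d i"
    "\<And>r. psd_mat_pow M r = spectral Q (\<lambda>i. nonneg_pow (d i) r)"
    using psd_obtain_diagonalisation[OF assms] by metis
  show ?thesis unfolding Q(3)
    using psd_iff_eigenvalues[OF diagonalises_spectral[OF Q(1)]] Q(2) nonneg_pow_nonneg by blast
qed

lemma pd_psd_mat_pow:
  assumes "pd M"
  shows "pd (psd_mat_pow M r)"
proof -
  obtain Q d where Q: "diagonalises Q d M" "\<forall>i<m. 0 < d i"
    "\<And>r. psd_mat_pow M r = spectral Q (\<lambda>i. d i powr r)"
    using pd_obtain_diagonalisation[OF assms] by metis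
  have "\<forall>i<m. 0 < d i powr r" using Q(2) by force
  then show ?thesis unfolding Q(3)
    using pd_iff_eigenvalues[OF diagonalises_spectral[OF Q(1)]] by blast
qed

lemma psd_mat_pow_intertwine:
  assumes "psd M" "psd N" "T \<in> sq" "M * T = T * N"
  shows "psd_mat_pow M r * T = T * psd_mat_pow N r"
proof -
  obtain Q d where Q: "diagonalises Q d M" "psd_mat_pow M r = spectral Q (\<lambda>i. nonneg_pow (d i) r)"
    using psd_obtain_diagonalisation[OF assms(1)] by metis
  obtain R e where R: "diagonalises R e N" "psd_mat_pow N r = spectral R (\<lambda>i. nonneg_pow (e i) r)"
    using psd_obtain_diagonalisation[OF assms(2)] by metis
  show ?thesis unfolding Q(2) R(2)
    by (rule spectral_intertwine[OF Q(1) R(1) assms(3,4), where f = "\<lambda>x. nonneg_pow x r"])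
qed

lemma psd_mat_pow_zero [simp]:
  assumes "psd M" shows "psd_mat_pow M 0 = 1\<^sub>m m"
proof -
  obtain Q d where Q: "diagonalises Q d M" "psd_mat_pow M 0 = spectral Q (\<lambda>i. nonneg_pow (d i) 0)"
    using psd_obtain_diagonalisation[OF assms] by metis
  then show ?thesis using spectral_one by (simp add: nonneg_pow_def)
qed

lemma psd_mat_pow_one [simp]:
  assumes "psd M" shows "psd_mat_pow M 1 = M"
proof -
  obtain Q d where Q: "diagonalises Q d M" "\<forall>i<m. 0 \<le> d i"
    "psd_mat_pow M 1 = spectral Q (\<lambda>i. nonneg_pow (d i) 1)"
    using psd_obtain_diagonalisation[OF assms] by metis
  have "psd_mat_pow M 1 = spectral Q d"
    unfolding Q(3) by (rule spectral_cong) (use Q(2) in \<open>simp add: nonneg_pow_def\<close>)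
  then show ?thesis using diagonalisesD(4)[OF Q(1)] by simp
qed

lemma pd_pow_add:
  assumes "pd M"
  shows "psd_mat_pow M s * psd_mat_pow M t = psd_mat_pow M (s + t)"
proof -
  obtain Q d where Q: "diagonalises Q d M" "\<And>r. psd_mat_pow M r = spectral Q (\<lambda>i. d i powr r)"
    using pd_obtain_diagonalisation[OF assms] by metis
  show ?thesis unfolding Q(2) spectral_mult[OF Q(1)] by (simp add: powr_add)
qed

lemma pd_pow_pow:
  assumes "pd M"
  shows "psd_mat_pow (psd_mat_pow M s) t = psd_mat_pow M (s * t)"
proof -
  obtain Q d where Q: "diagonalises Q d M" "\<forall>i<m. 0 < d i"
    "\<And>r. psd_mat_pow M r = spectral Q (\<lambda>i. d i powr r)"
    using pd_obtain_diagonalisation[OF assms] by metis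
  have "psd (spectral Q (\<lambda>i. d i powr s))"
    using psd_iff_eigenvalues[OF diagonalises_spectral[OF Q(1)]] by simp
  then have "psd_mat_pow (psd_mat_pow M s) t = spectral Q (\<lambda>i. nonneg_pow (d i powr s) t)"
    unfolding Q(3) by (rule psd_mat_pow_spectral[OF diagonalises_spectral[OF Q(1)]])
  also have "\<dots> = spectral Q (\<lambda>i. d i powr (s * t))"
    using Q(2) by (intro spectral_cong) (auto simp: nonneg_pow_def powr_powr)
  finally show ?thesis unfolding Q(3) .
qed

end

section \<open>The Loewner-Heinz inequality for positive definite matrices\<close>

context fixed_dim
begin

lemma sq_one_left [simp]: "A \<in> sq \<Longrightarrow> 1\<^sub>m m * A = A"
  by (rule left_mult_one_mat)

lemma sq_one_right [simp]: "A \<in> sq \<Longrightarrow> A * 1\<^sub>m m = A"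
  by (rule right_mult_one_mat)

lemma pd_pow_sq [simp]: "pd M \<Longrightarrow> psd_mat_pow M t \<in> sq"
  using pd_psd_mat_pow pd_sq by blast

lemma pd_pow_transpose [simp]: "pd M \<Longrightarrow> (psd_mat_pow M t)\<^sup>T = psd_mat_pow M t"
  using pd_psd_mat_pow pdD(1) symmD(2) by blast

lemma pd_pow_zero [simp]: "pd M \<Longrightarrow> psd_mat_pow M 0 = 1\<^sub>m m"
  by (simp add: pd_imp_psd)

lemma pd_pow_one [simp]: "pd M \<Longrightarrow> psd_mat_pow M 1 = M"
  by (simp add: pd_imp_psd)

lemma pd_pow_add_left:
  "pd M \<Longrightarrow> X \<in> sq \<Longrightarrow>
    psd_mat_pow M s * (psd_mat_pow M t * X) = psd_mat_pow M (s + t) * X"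
  using pd_pow_add[of M s t] sq_assoc[of "psd_mat_pow M s" "psd_mat_pow M t" X] by simp

lemma pd_pow_add_vec:
  "pd M \<Longrightarrow> x \<in> vs \<Longrightarrow>
    psd_mat_pow M s *\<^sub>v (psd_mat_pow M t *\<^sub>v x) = psd_mat_pow M (s + t) *\<^sub>v x"
  using pd_pow_add[of M s t] sq_assoc_vec[of "psd_mat_pow M s" "psd_mat_pow M t" x] by simp

lemma pd_pow_scalar_prod:
  assumes "pd M" "x \<in> vs" "y \<in> vs"
  shows "(psd_mat_pow M s *\<^sub>v x) \<bullet> (psd_mat_pow M t *\<^sub>v y) = x \<bullet> (psd_mat_pow M (s + t) *\<^sub>v y)"
proof -
  have "symm (psd_mat_pow M s)" using pd_psd_mat_pow[OF assms(1)] pdD(1) by blast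
  then have "(psd_mat_pow M s *\<^sub>v x) \<bullet> (psd_mat_pow M t *\<^sub>v y)
      = x \<bullet> (psd_mat_pow M s *\<^sub>v (psd_mat_pow M t *\<^sub>v y))"
    using symm_swap[of "psd_mat_pow M s" x "psd_mat_pow M t *\<^sub>v y"] assms by simp
  then show ?thesis using assms by (simp only: pd_pow_add_vec)
qed

lemma pd_pow_vec_nonzero:
  assumes "pd M" "x \<in> vs" "x \<noteq> 0\<^sub>v m"
  shows "psd_mat_pow M s *\<^sub>v x \<noteq> 0\<^sub>v m"
proof
  assume 0: "psd_mat_pow M s *\<^sub>v x = 0\<^sub>v m"
  have "x = psd_mat_pow M (- s) *\<^sub>v (psd_mat_pow M s *\<^sub>v x)"
    unfolding pd_pow_add_vec[OF assms(1,2)] using assms by simp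
  also have "\<dots> = 0\<^sub>v m"
    unfolding 0 using carrier_matD[OF pd_pow_sq[OF assms(1)]] by (intro eq_vecI) (auto simp: scalar_prod_def)
  finally show False using assms by simp
qed

lemma qform_pow_congruence:
  assumes "pd M" "N \<in> sq" "x \<in> vs"
  shows "qform (psd_mat_pow M s * N * psd_mat_pow M s) x = qform N (psd_mat_pow M s *\<^sub>v x)"
  using qform_congruence[of "psd_mat_pow M s" N x] assms by (simp del: assoc_mult_mat)

lemma loewner_le_pow_congruence:
  assumes "pd L" "M \<in> sq" "N \<in> sq" "M \<preceq> N"
  shows "psd_mat_pow L s * M * psd_mat_pow L s \<preceq> psd_mat_pow L s * N * psd_mat_pow L s"
  using loewner_le_congruence[of "psd_mat_pow L s" M N] assms by (simp del: assoc_mult_mat)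

lemma pd_pow_congruence:
  assumes "pd M" "pd N"
  shows "pd (psd_mat_pow M s * N * psd_mat_pow M s)"
proof -
  have "symm (psd_mat_pow M s * N * psd_mat_pow M s)"
    using symm_congruence[of "psd_mat_pow M s" N] assms pdD by (simp del: assoc_mult_mat)
  then show ?thesis
    using assms pd_pow_vec_nonzero[OF assms(1)] pdD(2)[OF assms(2)]
    by (simp add: pd_def[of "psd_mat_pow M s * N * psd_mat_pow M s"] qform_pow_congruence
        del: assoc_mult_mat)
qed

lemma scalar_prod_am_gm:
  assumes "x \<in> vs" "y \<in> vs"
  shows "2 * (x \<bullet> y) \<le> x \<bullet> x + y \<bullet> y"
proof -
  have "0 \<le> (\<Sum>i<m. (x $ i - y $ i)\<^sup>2)" by (simp add: sum_nonneg)
  also have "\<dots> = (\<Sum>i<m. x $ i * x $ i) + (\<Sum>i<m. y $ i * y $ i) - 2 * (\<Sum>i<m. x $ i * y $ i)"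
    by (simp add: power2_eq_square algebra_simps sum.distrib sum_subtractf sum_distrib_left)
  finally show ?thesis using assms by (simp add: scalar_prod_def atLeast0LessThan)
qed

text \<open>
  Put \<open>g = (a + b) / 2\<close>. The claim says that \<open>C = A\<^sup>-\<^sup>g\<^sup>/\<^sup>2 * B\<^sup>g * A\<^sup>-\<^sup>g\<^sup>/\<^sup>2\<close> has no eigenvalue above 1. An
  eigenvector of \<open>C\<close> for \<open>d\<close> yields \<open>v\<close> with \<open>B\<^sup>g v = d A\<^sup>g v\<close>. Pairing this equation with
  \<open>w = A\<^sup>(\<^sup>b\<^sup>-\<^sup>a\<^sup>)\<^sup>/\<^sup>2 v\<close> gives \<open>d * (v \<bullet> A\<^sup>b v)\<close> on the right, and on the left the product of
  \<open>B\<^sup>a\<^sup>/\<^sup>2 w\<close> and \<open>B\<^sup>b\<^sup>/\<^sup>2 v\<close>, whose square norms are at most \<open>w \<bullet> A\<^sup>a w\<close> and \<open>v \<bullet> A\<^sup>b v\<close> by the two hypotheses.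
  Both bounds equal \<open>v \<bullet> A\<^sup>b v\<close>, hence \<open>d \<le> 1\<close>.
\<close>

lemma pow_loewner_le_midpoint:
  assumes A: "pd A" and B: "pd B"
    and a: "psd_mat_pow B a \<preceq> psd_mat_pow A a" and b: "psd_mat_pow B b \<preceq> psd_mat_pow A b"
  shows "psd_mat_pow B ((a + b) / 2) \<preceq> psd_mat_pow A ((a + b) / 2)"
proof -
  define g where "g = (a + b) / 2"
  define C where "C = psd_mat_pow A (- g / 2) * psd_mat_pow B g * psd_mat_pow A (- g / 2)"
  have C: "pd C" unfolding C_def by (rule pd_pow_congruence[OF A pd_psd_mat_pow[OF B]])
  obtain Q d where Q: "diagonalises Q d C" using symm_diagonalisable pdD(1)[OF C] by blast
  have "d i \<le> 1" if i: "i < m" for i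
  proof -
    obtain u where u: "u \<in> vs" "u \<noteq> 0\<^sub>v m" "C *\<^sub>v u = d i \<cdot>\<^sub>v u"
      using diagonalises_eigenvector[OF Q i] by metis
    define v where "v = psd_mat_pow A (- g / 2) *\<^sub>v u"
    have v: "v \<in> vs" "v \<noteq> 0\<^sub>v m"
      using u A pd_pow_vec_nonzero by (simp_all add: v_def)
    \<comment> \<open>Multiplying the eigenvector equation by \<open>A\<^sup>g\<^sup>/\<^sup>2\<close> frees \<open>B\<^sup>g v\<close>.\<close>
    have u_eq: "u = psd_mat_pow A (g / 2) *\<^sub>v v"
      unfolding v_def pd_pow_add_vec[OF A u(1)] using A u by simp
    have "C *\<^sub>v u = psd_mat_pow A (- g / 2) *\<^sub>v (psd_mat_pow B g *\<^sub>v v)"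
      using A B u by (simp add: C_def v_def sq_assoc sq_assoc_vec)
    then have "psd_mat_pow A (- g / 2) *\<^sub>v (psd_mat_pow B g *\<^sub>v v) = d i \<cdot>\<^sub>v u"
      using u(3) by simp
    then have "psd_mat_pow A (g / 2) *\<^sub>v (psd_mat_pow A (- g / 2) *\<^sub>v (psd_mat_pow B g *\<^sub>v v))
        = psd_mat_pow A (g / 2) *\<^sub>v (d i \<cdot>\<^sub>v u)" by simp
    also have "\<dots> = d i \<cdot>\<^sub>v (psd_mat_pow A (g / 2) *\<^sub>v u)"
      using A u by (simp add: mult_mat_vec[of _ m m])
    also have "psd_mat_pow A (g / 2) *\<^sub>v u = psd_mat_pow A g *\<^sub>v v"
      unfolding u_eq pd_pow_add_vec[OF A v(1)] by simp
    finally have Bv: "psd_mat_pow B g *\<^sub>v v = d i \<cdot>\<^sub>v (psd_mat_pow A g *\<^sub>v v)"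
      using A B v by (simp add: pd_pow_add_vec)
    define w where "w = psd_mat_pow A ((b - a) / 2) *\<^sub>v v"
    have w: "w \<in> vs" using A v by (simp add: w_def)
    define z where "z = qform (psd_mat_pow A b) v"
    have z: "z > 0" unfolding z_def using pdD(2)[OF pd_psd_mat_pow[OF A]] v by blast
    have eqs: "(b - a) / 2 + g = b" "a / 2 + b / 2 = g" "a / 2 + a / 2 = a" "b / 2 + b / 2 = b"
      "(b - a) / 2 + (a + (b - a) / 2) = b"
      by (simp_all add: g_def field_simps)
    have wz: "qform (psd_mat_pow A a) w = z"
      unfolding w_def pd_pow_add_vec[OF A v(1)] pd_pow_scalar_prod[OF A v(1) v(1)] eqs
      by (simp add: z_def)
    have "w \<bullet> (psd_mat_pow B g *\<^sub>v v) = d i * z"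
    proof -
      have "w \<bullet> (psd_mat_pow B g *\<^sub>v v) = d i * (w \<bullet> (psd_mat_pow A g *\<^sub>v v))"
        unfolding Bv using w A v by simp
      also have "w \<bullet> (psd_mat_pow A g *\<^sub>v v) = z"
        unfolding w_def pd_pow_scalar_prod[OF A v(1) v(1)] eqs z_def ..
      finally show ?thesis .
    qed
    then have "2 * (d i * z) = 2 * ((psd_mat_pow B (a / 2) *\<^sub>v w) \<bullet> (psd_mat_pow B (b / 2) *\<^sub>v v))"
      unfolding pd_pow_scalar_prod[OF B w v(1)] eqs by simp
    also have "\<dots> \<le> qform (psd_mat_pow B a) w + qform (psd_mat_pow B b) v"
      using scalar_prod_am_gm[of "psd_mat_pow B (a / 2) *\<^sub>v w" "psd_mat_pow B (b / 2) *\<^sub>v v"]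
      unfolding pd_pow_scalar_prod[OF B w v(1)] pd_pow_scalar_prod[OF B w w]
        pd_pow_scalar_prod[OF B v(1) v(1)] eqs
      using B v w by simp
    also have "\<dots> \<le> qform (psd_mat_pow A a) w + qform (psd_mat_pow A b) v"
      using loewner_leD[OF a w] loewner_leD[OF b v(1)] by simp
    also have "\<dots> = 2 * z" unfolding wz by (simp add: z_def)
    finally show "d i \<le> 1" using z by simp
  qed
  then have "C \<preceq> 1\<^sub>m m"
    using loewner_le_spectral[of Q d "\<lambda>_. 1"] diagonalisesD(1,4)[OF Q] spectral_one[OF Q] by simp
  then have "psd_mat_pow A (g / 2) * C * psd_mat_pow A (g / 2)
      \<preceq> psd_mat_pow A (g / 2) * 1\<^sub>m m * psd_mat_pow A (g / 2)"
    using A C by (intro loewner_le_pow_congruence) auto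
  moreover have "psd_mat_pow A (g / 2) * C * psd_mat_pow A (g / 2) = psd_mat_pow B g"
    using A B by (simp add: C_def pd_pow_add_left pd_pow_add sq_assoc sq_assoc_vec)
  moreover have "psd_mat_pow A (g / 2) * 1\<^sub>m m * psd_mat_pow A (g / 2) = psd_mat_pow A g"
    using A by (simp add: pd_pow_add)
  ultimately show ?thesis unfolding g_def by simp
qed

lemma continuous_qform_pow:
  assumes "pd M" "x \<in> vs"
  shows "continuous_on UNIV (\<lambda>t. qform (psd_mat_pow M t) x)"
proof -
  obtain Q d where Q: "diagonalises Q d M" "\<forall>i<m. 0 < d i"
    "\<And>r. psd_mat_pow M r = spectral Q (\<lambda>i. d i powr r)"
    using pd_obtain_diagonalisation[OF assms(1)] by metis
  show ?thesis
    unfolding Q(3) qform_spectral[OF diagonalisesD(1)[OF Q(1)] assms(2)]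
    by (intro continuous_intros) (use Q(2) in force)
qed

end

text \<open>
  A missing point \<open>t\<close> would lie strictly between a nearest element of \<open>E\<close> below and a nearest one above,
  and their midpoint contradicts the choice of one of them.
\<close>

lemma midpoint_closed_contains_interval:
  fixes E :: "real set"
  assumes E: "closed E" "0 \<in> E" "1 \<in> E"
    and mid: "\<And>a b. a \<in> E \<Longrightarrow> b \<in> E \<Longrightarrow> (a + b) / 2 \<in> E"
    and t: "0 \<le> t" "t \<le> 1"
  shows "t \<in> E"
proof (rule ccontr)
  assume notin: "t \<notin> E"
  have "compact (E \<inter> {0..t})" "compact (E \<inter> {t..1})"
    using compact_Int_closed[OF compact_Icc E(1)] by (simp_all add: inf_commute)
  moreover have "0 \<in> E \<inter> {0..t}" "1 \<in> E \<inter> {t..1}" using E t by auto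
  then have "E \<inter> {0..t} \<noteq> {}" "E \<inter> {t..1} \<noteq> {}" by blast+
  ultimately have "\<exists>lo\<in>E \<inter> {0..t}. \<forall>x\<in>E \<inter> {0..t}. x \<le> lo"
    "\<exists>hi\<in>E \<inter> {t..1}. \<forall>x\<in>E \<inter> {t..1}. hi \<le> x"
    using compact_attains_sup[of "E \<inter> {0..t}"] compact_attains_inf[of "E \<inter> {t..1}"] by simp_all
  then obtain lo hi where lo: "lo \<in> E \<inter> {0..t}" "\<And>x. x \<in> E \<inter> {0..t} \<Longrightarrow> x \<le> lo"
    and hi: "hi \<in> E \<inter> {t..1}" "\<And>x. x \<in> E \<inter> {t..1} \<Longrightarrow> hi \<le> x" by blast
  have lt: "lo < t" "t < hi" using lo(1) hi(1) notin by (auto simp: less_le)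
  have "(lo + hi) / 2 \<in> E" using mid lo(1) hi(1) by blast
  then show False
    using lo hi(2)[of "(lo + hi) / 2"] lo(2)[of "(lo + hi) / 2"] hi(1) lt
    by (cases "(lo + hi) / 2 \<le> t") auto
qed

context fixed_dim
begin

theorem loewner_heinz_pd:
  assumes A: "pd A" and B: "pd B" and le: "B \<preceq> A" and s: "0 \<le> s" "s \<le> 1"
  shows "psd_mat_pow B s \<preceq> psd_mat_pow A s"
proof -
  define E where "E = {t. psd_mat_pow B t \<preceq> psd_mat_pow A t}"
  have "s \<in> E"
  proof (rule midpoint_closed_contains_interval[OF _ _ _ _ s])
    have "E = (\<Inter>x\<in>vs. {t. qform (psd_mat_pow B t) x \<le> qform (psd_mat_pow A t) x})"
      by (auto simp: E_def loewner_le_def)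
    moreover have "closed {t. qform (psd_mat_pow B t) x \<le> qform (psd_mat_pow A t) x}"
      if "x \<in> vs" for x
      by (intro closed_Collect_le continuous_qform_pow A B that)
    ultimately show "closed E" by (simp add: closed_INT)
    show "0 \<in> E" "1 \<in> E" using A B le by (auto simp: E_def loewner_le_refl)
    show "(a + b) / 2 \<in> E" if "a \<in> E" "b \<in> E" for a b
      using that pow_loewner_le_midpoint[OF A B] by (simp add: E_def)
  qed
  then show ?thesis by (simp add: E_def)
qed

text \<open>
  With \<open>u = N\<^sup>-\<^sup>1 x\<close> and \<open>y = M\<^sup>-\<^sup>1 x\<close>, expanding \<open>0 \<le> (y - u) \<bullet> M (y - u)\<close> and replacing \<open>u \<bullet> M u\<close> by
  the larger \<open>u \<bullet> N u = x \<bullet> u\<close> leaves \<open>0 \<le> x \<bullet> y - x \<bullet> u\<close>.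
\<close>

lemma inverse_antimono:
  assumes M: "pd M" and N: "pd N" and le: "M \<preceq> N"
  shows "psd_mat_pow N (- 1) \<preceq> psd_mat_pow M (- 1)"
  unfolding loewner_le_def
proof safe
  fix x assume x: "x \<in> vs"
  define u where "u = psd_mat_pow N (- 1) *\<^sub>v x"
  define y where "y = psd_mat_pow M (- 1) *\<^sub>v x"
  have u: "u \<in> vs" and y: "y \<in> vs" using x M N by (simp_all add: u_def y_def)
  have My: "M *\<^sub>v y = x"
    using pd_pow_add_vec[OF M x, of 1 "- 1"] M x by (simp add: y_def)
  have Nu: "N *\<^sub>v u = x"
    using pd_pow_add_vec[OF N x, of 1 "- 1"] N x by (simp add: u_def)
  have Mu: "M *\<^sub>v u \<in> vs" using M u by simp
  have "y \<bullet> (M *\<^sub>v u) = x \<bullet> u"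
    using symm_swap[OF pdD(1)[OF M] y u] unfolding My .
  moreover have "M *\<^sub>v (y - u) = x - M *\<^sub>v u"
    using mult_minus_distrib_mat_vec[of M m m y u] M y u My by simp
  moreover have "0 \<le> qform M (y - u)"
    using psdD(2)[OF pd_imp_psd[OF M], of "y - u"] y u by simp
  ultimately have "0 \<le> y \<bullet> x - 2 * (x \<bullet> u) + qform M u"
    using x y u Mu comm_scalar_prod[OF x u]
    by (simp add: minus_scalar_prod_distrib[of _ m] scalar_prod_minus_distrib[of _ m])
  also have "\<dots> \<le> y \<bullet> x - 2 * (x \<bullet> u) + qform N u"
    using loewner_leD[OF le u] by simp
  also have "\<dots> = x \<bullet> y - x \<bullet> u"
    unfolding Nu using comm_scalar_prod[OF x u] comm_scalar_prod[OF x y] by simp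
  finally show "qform (psd_mat_pow N (- 1)) x \<le> qform (psd_mat_pow M (- 1)) x"
    by (simp add: u_def y_def)
qed

section \<open>The Furuta inequality for positive definite matrices\<close>

text \<open>
  Let \<open>a = (1 + 2r) / (p + 2r)\<close>, \<open>T = B\<^sup>r * A\<^sup>p\<^sup>/\<^sup>2\<close>, \<open>K = T * T\<^sup>T\<close> and \<open>L = T\<^sup>T * T\<close>. Intertwining gives
  \<open>K\<^sup>a = T * L\<^sup>a\<^sup>-\<^sup>1 * T\<^sup>T\<close>. As \<open>2r \<le> 1\<close>, Loewner-Heinz gives \<open>L \<preceq> A\<^sup>p\<^sup>+\<^sup>2\<^sup>r\<close>, and once more, with the exponent
  \<open>1 - a\<close> and inverses, \<open>A\<^sup>1\<^sup>-\<^sup>p \<preceq> L\<^sup>a\<^sup>-\<^sup>1\<close>. Hence \<open>K\<^sup>a\<close> is at least \<open>T * A\<^sup>1\<^sup>-\<^sup>p * T\<^sup>T = B\<^sup>r * A * B\<^sup>r\<close>, which is at least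
  \<open>B\<^sup>1\<^sup>+\<^sup>2\<^sup>r\<close>.
\<close>

lemma furuta_base:
  assumes A: "pd A" and B: "pd B" and le: "B \<preceq> A"
    and r: "0 \<le> r" "2 * r \<le> 1" and p: "1 \<le> p"
  shows "psd_mat_pow B (1 + 2 * r)
    \<preceq> psd_mat_pow (psd_mat_pow B r * psd_mat_pow A p * psd_mat_pow B r) ((1 + 2 * r) / (p + 2 * r))"
proof -
  define a where "a = (1 + 2 * r) / (p + 2 * r)"
  have pos: "p + 2 * r > 0" using r p by simp
  have a1: "1 - a = (p - 1) / (p + 2 * r)" using pos by (simp add: a_def field_simps)
  have a: "0 \<le> 1 - a" "1 - a \<le> 1" unfolding a1 using p r pos by (simp_all add: field_simps)
  have pa: "(p + 2 * r) * (1 - a) = p - 1" unfolding a1 using pos by simp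
  define K where "K = psd_mat_pow B r * psd_mat_pow A p * psd_mat_pow B r"
  define L where "L = psd_mat_pow A (p / 2) * psd_mat_pow B (2 * r) * psd_mat_pow A (p / 2)"
  define T where "T = psd_mat_pow B r * psd_mat_pow A (p / 2)"
  have K: "pd K" unfolding K_def by (rule pd_pow_congruence[OF B pd_psd_mat_pow[OF A]])
  have L: "pd L" unfolding L_def by (rule pd_pow_congruence[OF A pd_psd_mat_pow[OF B]])
  have T: "T \<in> sq" using A B by (simp add: T_def)
  have TT: "T\<^sup>T = psd_mat_pow A (p / 2) * psd_mat_pow B r"
    using A B by (simp add: T_def sq_transpose_mult)
  have K_eq: "K = T * T\<^sup>T" unfolding TT unfolding T_def K_def
    using A B by (simp add: pd_pow_add_left sq_assoc sq_assoc_vec)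
  have L_eq: "L = T\<^sup>T * T" unfolding TT unfolding T_def L_def
    using A B by (simp add: pd_pow_add_left sq_assoc sq_assoc_vec)
  have "K * T = T * L" unfolding K_eq L_eq using T by (simp add: sq_assoc)
  then have inter: "psd_mat_pow K (a - 1) * T = T * psd_mat_pow L (a - 1)"
    using psd_mat_pow_intertwine[OF pd_imp_psd[OF K] pd_imp_psd[OF L] T] by simp
  \<comment> \<open>Splitting off one factor \<open>K = T * T\<^sup>T\<close> leaves a power that can be moved across \<open>T\<close>.\<close>
  have "psd_mat_pow K a = psd_mat_pow K (a - 1) * K"
    using pd_pow_add[OF K, of "a - 1" 1] K by simp
  also have "\<dots> = psd_mat_pow K (a - 1) * T * T\<^sup>T" unfolding K_eq using K T by (simp add: K_eq sq_assoc sq_assoc_vec)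
  also have "\<dots> = T\<^sup>T\<^sup>T * psd_mat_pow L (a - 1) * T\<^sup>T" unfolding inter by simp
  finally have Ka: "psd_mat_pow K a = T\<^sup>T\<^sup>T * psd_mat_pow L (a - 1) * T\<^sup>T" .
  have N: "pd (psd_mat_pow A (p + 2 * r))" by (rule pd_psd_mat_pow[OF A])
  have "psd_mat_pow B (2 * r) \<preceq> psd_mat_pow A (2 * r)"
    by (rule loewner_heinz_pd[OF A B le]) (use r in auto)
  then have "L \<preceq> psd_mat_pow A (p / 2) * psd_mat_pow A (2 * r) * psd_mat_pow A (p / 2)"
    unfolding L_def using A B by (intro loewner_le_pow_congruence) auto
  also have "psd_mat_pow A (p / 2) * psd_mat_pow A (2 * r) * psd_mat_pow A (p / 2)
      = psd_mat_pow A (p + 2 * r)"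
    unfolding pd_pow_add[OF A] by (simp add: algebra_simps)
  finally have "L \<preceq> psd_mat_pow A (p + 2 * r)" .
  from loewner_heinz_pd[OF N L this a]
  have "psd_mat_pow L (1 - a) \<preceq> psd_mat_pow A (p - 1)"
    unfolding pd_pow_pow[OF A] pa .
  from inverse_antimono[OF pd_psd_mat_pow[OF L] pd_psd_mat_pow[OF A] this]
  have "psd_mat_pow A (1 - p) \<preceq> psd_mat_pow L (a - 1)"
    unfolding pd_pow_pow[OF A] pd_pow_pow[OF L] by simp
  then have "T\<^sup>T\<^sup>T * psd_mat_pow A (1 - p) * T\<^sup>T \<preceq> psd_mat_pow K a"
    unfolding Ka using T A L by (intro loewner_le_congruence) auto
  moreover have "T\<^sup>T\<^sup>T * psd_mat_pow A (1 - p) * T\<^sup>T = psd_mat_pow B r * A * psd_mat_pow B r"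
  proof -
    have "T\<^sup>T\<^sup>T * psd_mat_pow A (1 - p) * T\<^sup>T
        = psd_mat_pow B r * (psd_mat_pow A (p / 2 + (1 - p + p / 2)) * psd_mat_pow B r)"
      unfolding transpose_transpose unfolding TT unfolding T_def
      using A B by (simp add: pd_pow_add_left sq_assoc sq_assoc_vec)
    also have "p / 2 + (1 - p + p / 2) = 1" by simp
    finally show ?thesis using A B by (simp add: sq_assoc)
  qed
  moreover have "psd_mat_pow B r * B * psd_mat_pow B r \<preceq> psd_mat_pow B r * A * psd_mat_pow B r"
    using A B le by (intro loewner_le_pow_congruence) auto
  moreover have "psd_mat_pow B r * B * psd_mat_pow B r = psd_mat_pow B (1 + 2 * r)"
    using pd_pow_add[OF B, of r 1] pd_pow_add[OF B, of "r + 1" r] B by (simp add: algebra_simps)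
  ultimately have "psd_mat_pow B (1 + 2 * r) \<preceq> psd_mat_pow K a"
    using loewner_le_trans by metis
  then show ?thesis by (simp add: K_def a_def)
qed

text \<open>
  The case \<open>s\<close> is a comparison \<open>B1 \<preceq> A1\<close> of positive definite matrices. The base case with exponent
  \<open>1/2\<close> for this pair, and with \<open>p1\<close> chosen so that \<open>A1\<close> to the power \<open>p1\<close> undoes the outer power,
  is the case \<open>r = 2 * s + 1/2\<close>. Starting from \<open>[0, 1/2]\<close>, each step lengthens the interval of admissible
  \<open>r\<close> by at least 1.
\<close>

lemma furuta_critical:
  assumes A: "pd A" and B: "pd B" and le: "B \<preceq> A" and r: "0 \<le> r" and p: "1 \<le> p"
  shows "psd_mat_pow B (1 + 2 * r)
    \<preceq> psd_mat_pow (psd_mat_pow B r * psd_mat_pow A p * psd_mat_pow B r) ((1 + 2 * r) / (p + 2 * r))"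
proof -
  obtain k :: nat where "r \<le> real k + 1 / 2"
    using real_arch_simple[of r] by (metis add_increasing2 divide_nonneg_nonneg zero_le_numeral zero_le_one)
  then show ?thesis using r
  proof (induction k arbitrary: r)
    case 0
    then show ?case by (intro furuta_base[OF A B le _ _ p]) auto
  next
    case (Suc k)
    show ?case
    proof (cases "2 * r \<le> 1")
      case True
      then show ?thesis using Suc.prems by (intro furuta_base[OF A B le _ _ p]) auto
    next
      case False
      define s where "s = r / 2 - 1 / 4"
      have s: "0 \<le> s" "s \<le> real k + 1 / 2" and r_eq: "r = 2 * s + 1 / 2"
        using False Suc.prems by (simp_all add: s_def field_simps)
      define A1 where "A1 = psd_mat_pow (psd_mat_pow B s * psd_mat_pow A p * psd_mat_pow B s)
        ((1 + 2 * s) / (p + 2 * s))"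
      define B1 where "B1 = psd_mat_pow B (1 + 2 * s)"
      define p1 where "p1 = (p + 2 * s) / (1 + 2 * s)"
      have K: "pd (psd_mat_pow B s * psd_mat_pow A p * psd_mat_pow B s)"
        by (rule pd_pow_congruence[OF B pd_psd_mat_pow[OF A]])
      have A1: "pd A1" unfolding A1_def by (rule pd_psd_mat_pow[OF K])
      have B1: "pd B1" unfolding B1_def by (rule pd_psd_mat_pow[OF B])
      have le1: "B1 \<preceq> A1" unfolding A1_def B1_def by (rule Suc.IH[OF s(2,1)])
      have p1: "1 \<le> p1" using s p by (simp add: p1_def field_simps)
      have A1p: "psd_mat_pow A1 p1 = psd_mat_pow B s * psd_mat_pow A p * psd_mat_pow B s"
      proof -
        have e1: "(1 + 2 * s) / (p + 2 * s) * p1 = 1" using s p by (simp add: p1_def)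
        show ?thesis unfolding A1_def pd_pow_pow[OF K] e1 by (rule pd_pow_one[OF K])
      qed
      have B1h: "psd_mat_pow B1 (1 / 2) = psd_mat_pow B (s + 1 / 2)"
        unfolding B1_def pd_pow_pow[OF B] by (simp add: field_simps)
      have B12: "psd_mat_pow B1 (1 + 2 * (1 / 2)) = psd_mat_pow B (1 + 2 * r)"
      proof -
        have "(1 + 2 * s) * (1 + 2 * (1 / 2)) = 1 + 2 * r" by (simp add: r_eq)
        then show ?thesis unfolding B1_def pd_pow_pow[OF B] by (simp only:)
      qed
      have e: "(1 + 2 * (1 / 2)) / (p1 + 2 * (1 / 2)) = (1 + 2 * r) / (p + 2 * r)"
      proof -
        have "p1 + 2 * (1 / 2) = (p + 2 * r) / (1 + 2 * s)"
          using s by (simp add: p1_def r_eq field_simps)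
        moreover have "1 + 2 * r = 2 * (1 + 2 * s)" by (simp add: r_eq)
        ultimately show ?thesis by simp
      qed
      have K1: "psd_mat_pow B1 (1 / 2) * psd_mat_pow A1 p1 * psd_mat_pow B1 (1 / 2)
          = psd_mat_pow B r * psd_mat_pow A p * psd_mat_pow B r"
      proof -
        have "s + 1 / 2 + s = r" "s + (s + 1 / 2) = r" by (simp_all add: r_eq)
        then show ?thesis unfolding A1p B1h using A B by (simp add: pd_pow_add_left pd_pow_add sq_assoc sq_assoc_vec)
      qed
      have "psd_mat_pow B1 (1 + 2 * (1 / 2))
        \<preceq> psd_mat_pow (psd_mat_pow B1 (1 / 2) * psd_mat_pow A1 p1 * psd_mat_pow B1 (1 / 2))
            ((1 + 2 * (1 / 2)) / (p1 + 2 * (1 / 2)))"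
        by (rule furuta_base[OF A1 B1 le1 _ _ p1]) auto
      then show ?thesis unfolding K1 e B12 .
    qed
  qed
qed

text \<open>
  For \<open>p \<le> 1\<close> already \<open>B\<^sup>p \<preceq> A\<^sup>p\<close>. For \<open>p > 1\<close>, raise the critical inequality to the power \<open>c\<close> that
  turns the critical exponent into \<open>1/q\<close>; the hypothesis on \<open>q\<close> says exactly that \<open>c \<le> 1\<close>.
\<close>

theorem furuta_pd_lower:
  assumes A: "pd A" and B: "pd B" and le: "B \<preceq> A"
    and r: "0 \<le> r" and p: "0 \<le> p" and q: "1 \<le> q" and pq: "p + 2 * r \<le> (1 + 2 * r) * q"
  shows "psd_mat_pow B ((p + 2 * r) / q)
    \<preceq> psd_mat_pow (psd_mat_pow B r * psd_mat_pow A p * psd_mat_pow B r) (1 / q)"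
proof -
  define K where "K = psd_mat_pow B r * psd_mat_pow A p * psd_mat_pow B r"
  have K: "pd K" unfolding K_def by (rule pd_pow_congruence[OF B pd_psd_mat_pow[OF A]])
  have "psd_mat_pow B ((p + 2 * r) / q) \<preceq> psd_mat_pow K (1 / q)"
  proof (cases "p \<le> 1")
    case True
    have "psd_mat_pow B p \<preceq> psd_mat_pow A p"
      by (rule loewner_heinz_pd[OF A B le p True])
    then have "psd_mat_pow B r * psd_mat_pow B p * psd_mat_pow B r \<preceq> K"
      unfolding K_def using A B by (intro loewner_le_pow_congruence) auto
    moreover have "psd_mat_pow B r * psd_mat_pow B p * psd_mat_pow B r = psd_mat_pow B (p + 2 * r)"
      unfolding pd_pow_add[OF B] by (simp add: algebra_simps)
    ultimately have "psd_mat_pow B (p + 2 * r) \<preceq> K" by simp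
    from loewner_heinz_pd[OF K pd_psd_mat_pow[OF B] this, of "1 / q"] q show ?thesis
      unfolding pd_pow_pow[OF B] by simp
  next
    case False
    define c where "c = (p + 2 * r) / ((1 + 2 * r) * q)"
    have c: "0 \<le> c" "c \<le> 1" using r p q pq by (simp_all add: c_def)
    have e: "(1 + 2 * r) * c = (p + 2 * r) / q" "(1 + 2 * r) / (p + 2 * r) * c = 1 / q"
      using r False q by (simp_all add: c_def)
    have "psd_mat_pow B (1 + 2 * r) \<preceq> psd_mat_pow K ((1 + 2 * r) / (p + 2 * r))"
      unfolding K_def by (rule furuta_critical[OF A B le r]) (use False in simp)
    from loewner_heinz_pd[OF pd_psd_mat_pow[OF K] pd_psd_mat_pow[OF B] this c]
    show ?thesis unfolding pd_pow_pow[OF B] pd_pow_pow[OF K] e .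
  qed
  then show ?thesis by (simp add: K_def)
qed

text \<open>
  The lower inequality for \<open>A\<^sup>-\<^sup>1 \<preceq> B\<^sup>-\<^sup>1\<close> compares the inverses of the two sides, in reverse order.
\<close>

theorem furuta_pd_upper:
  assumes A: "pd A" and B: "pd B" and le: "B \<preceq> A"
    and r: "0 \<le> r" and p: "0 \<le> p" and q: "1 \<le> q" and pq: "p + 2 * r \<le> (1 + 2 * r) * q"
  shows "psd_mat_pow (psd_mat_pow A r * psd_mat_pow B p * psd_mat_pow A r) (1 / q)
    \<preceq> psd_mat_pow A ((p + 2 * r) / q)"
proof -
  define K where "K = psd_mat_pow A r * psd_mat_pow B p * psd_mat_pow A r"
  have K: "pd K" unfolding K_def by (rule pd_pow_congruence[OF A pd_psd_mat_pow[OF B]])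
  have Ki: "psd_mat_pow A (- r) * psd_mat_pow B (- p) * psd_mat_pow A (- r) = psd_mat_pow K (- 1)"
    (is "?X = _")
  proof -
    have X: "?X \<in> sq" using A B by simp
    have "?X * K = 1\<^sub>m m" unfolding K_def using A B by (simp add: pd_pow_add_left pd_pow_add sq_assoc sq_assoc_vec)
    then have "?X * K * psd_mat_pow K (- 1) = psd_mat_pow K (- 1)"
      using K by (simp add:)
    moreover have "K * psd_mat_pow K (- 1) = 1\<^sub>m m"
      using pd_pow_add[OF K, of 1 "- 1"] K by simp
    ultimately show ?thesis
      using sq_assoc[OF X pd_sq[OF K] pd_pow_sq[OF K], of "- 1"] X
      by (simp del: assoc_mult_mat)
  qed
  have "psd_mat_pow (psd_mat_pow A (- 1)) ((p + 2 * r) / q)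
    \<preceq> psd_mat_pow (psd_mat_pow (psd_mat_pow A (- 1)) r * psd_mat_pow (psd_mat_pow B (- 1)) p
        * psd_mat_pow (psd_mat_pow A (- 1)) r) (1 / q)"
    by (rule furuta_pd_lower[OF pd_psd_mat_pow[OF B] pd_psd_mat_pow[OF A]
          inverse_antimono[OF B A le] r p q pq])
  then have "psd_mat_pow A (- ((p + 2 * r) / q)) \<preceq> psd_mat_pow K (- (1 / q))"
    unfolding pd_pow_pow[OF A] pd_pow_pow[OF B] mult_minus1 Ki pd_pow_pow[OF K] .
  from inverse_antimono[OF pd_psd_mat_pow[OF A] pd_psd_mat_pow[OF K] this] show ?thesis
    unfolding pd_pow_pow[OF A] pd_pow_pow[OF K] by (simp add: K_def)
qed

end

section \<open>Passage to positive semidefinite matrices\<close>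

lemma powr_add_le_add_powr:
  fixes a b s :: real
  assumes "0 \<le> a" "0 \<le> b" "0 < s" "s \<le> 1"
  shows "(a + b) powr s \<le> a powr s + b powr s"
proof (cases "a + b = 0")
  case True
  then show ?thesis using assms by simp
next
  case False
  then have pos: "a + b > 0" using assms by simp
  have le: "u \<le> u powr s" if "0 \<le> u" "u \<le> 1" for u :: real
    using powr_mono'[of s 1 u] that assms by simp
  have "1 = a / (a + b) + b / (a + b)" using pos by (simp add: add_divide_distrib[symmetric])
  also have "\<dots> \<le> (a / (a + b)) powr s + (b / (a + b)) powr s"
    by (intro add_mono le) (use assms pos in auto)
  also have "\<dots> = (a powr s + b powr s) / (a + b) powr s"
    using assms pos by (simp add: powr_divide add_divide_distrib)
  finally show ?thesis using pos by (simp add: field_simps)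
qed

lemma tendsto_nonneg_pow:
  assumes "0 \<le> d" "0 \<le> t" "e \<longlonglongrightarrow> 0" "\<And>k. 0 \<le> e k"
  shows "(\<lambda>k. nonneg_pow (d + e k) t) \<longlonglongrightarrow> nonneg_pow d t"
proof (cases "t = 0")
  case True
  then show ?thesis by (simp add: nonneg_pow_def)
next
  case False
  have "(\<lambda>k. d + e k) \<longlonglongrightarrow> d + 0" by (intro tendsto_intros assms)
  from tendsto_powr'[OF this tendsto_const, of t]
  have "(\<lambda>k. (d + e k) powr t) \<longlonglongrightarrow> (d + 0) powr t" using assms False by simp
  then show ?thesis using False by (simp add: nonneg_pow_def)
qed

lemma nonneg_pow_mono: "0 \<le> a \<Longrightarrow> a \<le> b \<Longrightarrow> 0 \<le> t \<Longrightarrow> nonneg_pow a t \<le> nonneg_pow b t"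
  by (simp add: nonneg_pow_def powr_mono2)

context fixed_dim
begin

lemma qform_add_scalar:
  assumes "M \<in> sq" "x \<in> vs"
  shows "qform (M + e \<cdot>\<^sub>m 1\<^sub>m m) x = qform M x + e * (x \<bullet> x)"
proof -
  have "(e \<cdot>\<^sub>m 1\<^sub>m m) *\<^sub>v x = e \<cdot>\<^sub>v x" using assms by (intro eq_vecI) auto
  then have "(M + e \<cdot>\<^sub>m 1\<^sub>m m) *\<^sub>v x = M *\<^sub>v x + e \<cdot>\<^sub>v x"
    using assms add_mult_distrib_mat_vec[of M m m "e \<cdot>\<^sub>m 1\<^sub>m m" x] by simp
  then show ?thesis using assms by (simp add: scalar_prod_add_distrib[of _ m])
qed

lemma sq_mult_index:
  assumes "A \<in> sq" "B \<in> sq" "i < m" "j < m"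
  shows "(A * B) $$ (i, j) = (\<Sum>l<m. A $$ (i, l) * B $$ (l, j))"
  using assms by (simp add: scalar_prod_def atLeast0LessThan)

lemma spectral_index:
  assumes "Q \<in> sq" "i < m" "j < m"
  shows "spectral Q f $$ (i, j) = (\<Sum>k<m. Q $$ (i, k) * f k * Q $$ (j, k))"
proof -
  have "spectral Q f $$ (i, j) = (\<Sum>k<m. (Q * mat_diag m f) $$ (i, k) * Q\<^sup>T $$ (k, j))"
    using assms unfolding spectral_def by (intro sq_mult_index) auto
  also have "\<dots> = (\<Sum>k<m. Q $$ (i, k) * f k * Q $$ (j, k))"
    using assms by (intro sum.cong) (auto simp: mat_mult_mat_diag_index simp del: index_mult_mat(1))
  finally show ?thesis .
qed

lemma diagonalises_add_scalar:
  assumes "diagonalises Q d M"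
  shows "diagonalises Q (\<lambda>i. d i + e) (M + e \<cdot>\<^sub>m 1\<^sub>m m)"
proof -
  note D = diagonalisesD[OF assms]
  have "spectral Q (\<lambda>i. d i + e) = spectral Q d + e \<cdot>\<^sub>m spectral Q (\<lambda>_. 1)"
  proof (rule eq_matI)
    fix i j assume "i < dim_row (spectral Q d + e \<cdot>\<^sub>m spectral Q (\<lambda>_. 1))"
      "j < dim_col (spectral Q d + e \<cdot>\<^sub>m spectral Q (\<lambda>_. 1))"
    then have ij: "i < m" "j < m" using carrier_matD[OF spectral_sq[OF D(1)]] by auto
    then show "spectral Q (\<lambda>i. d i + e) $$ (i, j)
        = (spectral Q d + e \<cdot>\<^sub>m spectral Q (\<lambda>_. 1)) $$ (i, j)"
      using carrier_matD[OF spectral_sq[OF D(1)]]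
      by (simp add: spectral_index[OF D(1)] sum.distrib sum_distrib_left distrib_left distrib_right
          mult_ac)
  qed (use carrier_matD[OF spectral_sq[OF D(1)]] in auto)
  then have "M + e \<cdot>\<^sub>m 1\<^sub>m m = spectral Q (\<lambda>i. d i + e)"
    unfolding spectral_one[OF assms] D(4)[symmetric] by simp
  then show ?thesis using diagonalises_spectral[OF assms] by simp
qed

text \<open>
  The perturbed matrix has the same eigenvectors, so that one orthogonal matrix serves all \<open>e\<close>.
\<close>

lemma psd_pow_add_scalar:
  assumes "psd M"
  obtains Q d where "Q \<in> sq" "\<forall>i<m. 0 \<le> d i"
    "\<And>r. psd_mat_pow M r = spectral Q (\<lambda>i. nonneg_pow (d i) r)"
    "\<And>e r. 0 \<le> e \<Longrightarrow>
      psd_mat_pow (M + e \<cdot>\<^sub>m 1\<^sub>m m) r = spectral Q (\<lambda>i. nonneg_pow (d i + e) r)"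
    "\<And>e. 0 < e \<Longrightarrow> pd (M + e \<cdot>\<^sub>m 1\<^sub>m m)"
proof -
  obtain Q d where Q: "diagonalises Q d M" "\<forall>i<m. 0 \<le> d i"
    "\<And>r. psd_mat_pow M r = spectral Q (\<lambda>i. nonneg_pow (d i) r)"
    using psd_obtain_diagonalisation[OF assms] by metis
  note De = diagonalises_add_scalar[OF Q(1)]
  show thesis
  proof
    show "Q \<in> sq" using diagonalisesD(1)[OF Q(1)] .
    show "\<forall>i<m. 0 \<le> d i" "\<And>r. psd_mat_pow M r = spectral Q (\<lambda>i. nonneg_pow (d i) r)"
      using Q(2,3) .
    fix e :: real
    show "psd_mat_pow (M + e \<cdot>\<^sub>m 1\<^sub>m m) r = spectral Q (\<lambda>i. nonneg_pow (d i + e) r)" if "0 \<le> e" for r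
      by (rule psd_mat_pow_spectral[OF De]) (use psd_iff_eigenvalues[OF De] Q(2) that in auto)
    show "pd (M + e \<cdot>\<^sub>m 1\<^sub>m m)" if "0 < e"
      using pd_iff_eigenvalues[OF De] Q(2) that by (auto intro: add_nonneg_pos)
  qed
qed

lemma pd_add_scalar: "psd M \<Longrightarrow> 0 < e \<Longrightarrow> pd (M + e \<cdot>\<^sub>m 1\<^sub>m m)"
  using psd_pow_add_scalar by metis

lemma pow_le_pow_add_scalar:
  assumes "psd M" "0 \<le> e" "0 \<le> t"
  shows "psd_mat_pow M t \<preceq> psd_mat_pow (M + e \<cdot>\<^sub>m 1\<^sub>m m) t"
proof -
  obtain Q d where Q: "Q \<in> sq" "\<forall>i<m. 0 \<le> d i"
    "\<And>r. psd_mat_pow M r = spectral Q (\<lambda>i. nonneg_pow (d i) r)"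
    "\<And>e r. 0 \<le> e \<Longrightarrow>
      psd_mat_pow (M + e \<cdot>\<^sub>m 1\<^sub>m m) r = spectral Q (\<lambda>i. nonneg_pow (d i + e) r)"
    using psd_pow_add_scalar[OF assms(1)] by metis
  show ?thesis unfolding Q(3) Q(4)[OF assms(2)]
    by (rule loewner_le_spectral[OF Q(1)]) (use Q(2) assms in \<open>auto intro!: nonneg_pow_mono\<close>)
qed

lemma qform_pow_add_scalar_le:
  assumes "psd M" "0 \<le> e" "0 < s" "s \<le> 1" "x \<in> vs"
  shows "qform (psd_mat_pow (M + e \<cdot>\<^sub>m 1\<^sub>m m) s) x
    \<le> qform (psd_mat_pow M s) x + e powr s * (x \<bullet> x)"
proof -
  obtain Q d where Q: "Q \<in> sq" "\<forall>i<m. 0 \<le> d i" "diagonalises Q d M"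
    "\<And>r. psd_mat_pow M r = spectral Q (\<lambda>i. nonneg_pow (d i) r)"
    using psd_obtain_diagonalisation[OF assms(1)] diagonalisesD(1) by metis
  note De = diagonalises_add_scalar[OF Q(3)]
  have "psd (M + e \<cdot>\<^sub>m 1\<^sub>m m)" using psd_iff_eigenvalues[OF De] Q(2) assms(2) by auto
  from psd_mat_pow_spectral[OF De this, of s]
  have "qform (psd_mat_pow (M + e \<cdot>\<^sub>m 1\<^sub>m m) s) x = qform (spectral Q (\<lambda>i. nonneg_pow (d i + e) s)) x"
    by simp
  also have "\<dots> \<le> qform (spectral Q (\<lambda>i. nonneg_pow (d i) s + e powr s)) x"
    by (rule loewner_leD[OF loewner_le_spectral[OF Q(1)] assms(5)])
      (use Q(2) assms in \<open>auto simp: nonneg_pow_def powr_add_le_add_powr\<close>)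
  also have "spectral Q (\<lambda>i. nonneg_pow (d i) s + e powr s)
      = psd_mat_pow M s + (e powr s) \<cdot>\<^sub>m 1\<^sub>m m"
    using diagonalisesD(4)[OF diagonalises_add_scalar[OF diagonalises_spectral[OF Q(3)]]]
    unfolding Q(4) by simp
  also have "qform \<dots> x = qform (psd_mat_pow M s) x + e powr s * (x \<bullet> x)"
    using psd_psd_mat_pow[OF assms(1)] assms(5) by (intro qform_add_scalar) auto
  finally show ?thesis .
qed

text \<open>
  A Hoelder estimate for powers of exponent at most 1, for matrices that need not commute. A further
  multiple \<open>e\<close> of the identity is added to both sides because Loewner-Heinz is available for positive
  definite matrices only; this accounts for the factor 2.
\<close>

lemma pow_stability:
  assumes X: "psd X" and Y: "psd Y" and e: "0 < e" and s: "0 < s" "s \<le> 1"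
    and le: "X \<preceq> Y + e \<cdot>\<^sub>m 1\<^sub>m m" and x: "x \<in> vs"
  shows "qform (psd_mat_pow X s) x \<le> qform (psd_mat_pow Y s) x + (2 * e) powr s * (x \<bullet> x)"
proof -
  have "X + e \<cdot>\<^sub>m 1\<^sub>m m \<preceq> Y + (2 * e) \<cdot>\<^sub>m 1\<^sub>m m"
    unfolding loewner_le_def
  proof safe
    fix y assume y: "y \<in> vs"
    show "qform (X + e \<cdot>\<^sub>m 1\<^sub>m m) y \<le> qform (Y + (2 * e) \<cdot>\<^sub>m 1\<^sub>m m) y"
      using loewner_leD[OF le y]
      unfolding qform_add_scalar[OF psd_sq[OF X] y] qform_add_scalar[OF psd_sq[OF Y] y] by simp
  qed
  then have "psd_mat_pow (X + e \<cdot>\<^sub>m 1\<^sub>m m) s \<preceq> psd_mat_pow (Y + (2 * e) \<cdot>\<^sub>m 1\<^sub>m m) s"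
    using pd_add_scalar[OF X] pd_add_scalar[OF Y] e s by (intro loewner_heinz_pd) auto
  from loewner_leD[OF this x] loewner_leD[OF pow_le_pow_add_scalar[OF X, of e s] x]
    qform_pow_add_scalar_le[OF Y _ s x, of "2 * e"] e s
  show ?thesis by simp
qed

definition entrywise_lim :: "(nat \<Rightarrow> real mat) \<Rightarrow> real mat \<Rightarrow> bool" where
  "entrywise_lim X L \<longleftrightarrow> (\<forall>k. X k \<in> sq) \<and> L \<in> sq \<and>
     (\<forall>i<m. \<forall>j<m. (\<lambda>k. X k $$ (i, j)) \<longlonglongrightarrow> L $$ (i, j))"

lemma entrywise_lim_mult:
  assumes "entrywise_lim X L" "entrywise_lim Y M"
  shows "entrywise_lim (\<lambda>k. X k * Y k) (L * M)"
  unfolding entrywise_lim_def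
proof (intro conjI allI impI)
  have sq: "X k \<in> sq" "Y k \<in> sq" "L \<in> sq" "M \<in> sq" for k
    using assms by (auto simp: entrywise_lim_def)
  show "X k * Y k \<in> sq" "L * M \<in> sq" for k using sq by auto
  fix i j assume ij: "i < m" "j < m"
  have "(\<lambda>k. \<Sum>l<m. X k $$ (i, l) * Y k $$ (l, j)) \<longlonglongrightarrow> (\<Sum>l<m. L $$ (i, l) * M $$ (l, j))"
    using assms ij by (intro tendsto_sum tendsto_mult) (auto simp: entrywise_lim_def)
  then show "(\<lambda>k. (X k * Y k) $$ (i, j)) \<longlonglongrightarrow> (L * M) $$ (i, j)"
    by (simp only: sq_mult_index sq ij)
qed

lemma qform_sum:
  assumes "M \<in> sq" "x \<in> vs"
  shows "qform M x = (\<Sum>i<m. \<Sum>j<m. x $ i * (M $$ (i, j) * x $ j))"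
  using assms by (simp add: scalar_prod_def atLeast0LessThan sum_distrib_left)

lemma entrywise_lim_loewner:
  assumes lim: "entrywise_lim X L" and e: "0 < e"
  shows "\<forall>\<^sub>F k in sequentially. X k \<preceq> L + e \<cdot>\<^sub>m 1\<^sub>m m \<and> L \<preceq> X k + e \<cdot>\<^sub>m 1\<^sub>m m"
proof -
  have sq: "X k \<in> sq" "L \<in> sq" for k using lim by (auto simp: entrywise_lim_def)
  \<comment> \<open>As \<open>\<bar>x $ i\<bar> * \<bar>x $ j\<bar> \<le> x \<bullet> x\<close>, this sum bounds the quadratic form of the difference.\<close>
  define c where "c k = (\<Sum>i<m. \<Sum>j<m. \<bar>X k $$ (i, j) - L $$ (i, j)\<bar>)" for k
  have "c \<longlonglongrightarrow> (\<Sum>i<m. \<Sum>j<m. \<bar>L $$ (i, j) - L $$ (i, j)\<bar>)"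
    unfolding c_def using lim
    by (intro tendsto_sum tendsto_rabs tendsto_diff tendsto_const) (auto simp: entrywise_lim_def)
  then have "c \<longlonglongrightarrow> 0" by simp
  then have "\<forall>\<^sub>F k in sequentially. c k < e" using e by (rule order_tendstoD)
  then show ?thesis
  proof (rule eventually_mono)
    fix k assume ck: "c k < e"
    have diff: "\<bar>qform (X k) x - qform L x\<bar> \<le> e * (x \<bullet> x)" if x: "x \<in> vs" for x
    proof -
      have xx: "x \<bullet> x = (\<Sum>i<m. (x $ i)\<^sup>2)"
        using x by (simp add: scalar_prod_def atLeast0LessThan power2_eq_square)
      have nn: "0 \<le> x \<bullet> x" unfolding xx by (simp add: sum_nonneg)
      have prod: "\<bar>x $ i\<bar> * \<bar>x $ j\<bar> \<le> x \<bullet> x" if "i < m" "j < m" for i j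
      proof -
        have sqb: "(x $ l)\<^sup>2 \<le> x \<bullet> x" if "l < m" for l
          unfolding xx using that by (intro member_le_sum) auto
        have "2 * (\<bar>x $ i\<bar> * \<bar>x $ j\<bar>) \<le> (x $ i)\<^sup>2 + (x $ j)\<^sup>2"
          using sum_squares_bound[of "\<bar>x $ i\<bar>" "\<bar>x $ j\<bar>"] by simp
        then show ?thesis using sqb[OF \<open>i < m\<close>] sqb[OF \<open>j < m\<close>] by simp
      qed
      have "qform (X k) x - qform L x
          = (\<Sum>i<m. \<Sum>j<m. (X k $$ (i, j) - L $$ (i, j)) * (x $ i * x $ j))"
        unfolding qform_sum[OF sq(1) x] qform_sum[OF sq(2) x] sum_subtractf[symmetric]
        by (simp add: algebra_simps)
      also have "\<bar>\<dots>\<bar> \<le> (\<Sum>i<m. \<Sum>j<m. \<bar>X k $$ (i, j) - L $$ (i, j)\<bar> * (x \<bullet> x))"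
      proof (intro order_trans[OF sum_abs] sum_mono)
        fix i j assume "i \<in> {..<m}" "j \<in> {..<m}"
        then show "\<bar>(X k $$ (i, j) - L $$ (i, j)) * (x $ i * x $ j)\<bar>
            \<le> \<bar>X k $$ (i, j) - L $$ (i, j)\<bar> * (x \<bullet> x)"
          using prod[of i j] by (simp add: abs_mult mult_left_mono)
      qed
      also have "\<dots> = c k * (x \<bullet> x)" by (simp add: c_def sum_distrib_right)
      also have "\<dots> \<le> e * (x \<bullet> x)" using ck nn by (intro mult_right_mono) auto
      finally show ?thesis .
    qed
    show "X k \<preceq> L + e \<cdot>\<^sub>m 1\<^sub>m m \<and> L \<preceq> X k + e \<cdot>\<^sub>m 1\<^sub>m m"
      unfolding loewner_le_def
    proof (intro conjI ballI)
      fix x assume x: "x \<in> vs"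
      show "qform (X k) x \<le> qform (L + e \<cdot>\<^sub>m 1\<^sub>m m) x"
        "qform L x \<le> qform (X k + e \<cdot>\<^sub>m 1\<^sub>m m) x"
        using diff[OF x] unfolding qform_add_scalar[OF sq(1) x] qform_add_scalar[OF sq(2) x]
        by (simp_all add: abs_le_iff)
    qed
  qed
qed

text \<open>
  Stability in both directions makes the power continuous along any convergent sequence. The tolerance
  \<open>d\<close> is solved from \<open>(2 * d) powr s = c\<close>.
\<close>

lemma tendsto_qform_pow:
  assumes lim: "entrywise_lim X L" and X: "\<And>k. psd (X k)" and L: "psd L"
    and s: "0 < s" "s \<le> 1" and x: "x \<in> vs"
  shows "(\<lambda>k. qform (psd_mat_pow (X k) s) x) \<longlonglongrightarrow> qform (psd_mat_pow L s) x"
proof (rule tendstoI)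
  fix e :: real assume e: "0 < e"
  have nn: "0 \<le> x \<bullet> x" using x by (simp add: scalar_prod_def sum_nonneg)
  \<comment> \<open>Adding 1 keeps the denominator positive when \<open>x\<close> is zero.\<close>
  define c where "c = e / (x \<bullet> x + 1)"
  have c: "0 < c" using e nn by (simp add: c_def)
  define d where "d = c powr (1 / s) / 2"
  have d: "0 < d" using c by (simp add: d_def)
  have ds: "(2 * d) powr s = c" using c s by (simp add: d_def powr_powr)
  have cx: "c * (x \<bullet> x) < e" using e nn by (simp add: c_def field_simps)
  from entrywise_lim_loewner[OF lim d]
  show "\<forall>\<^sub>F k in sequentially. dist (qform (psd_mat_pow (X k) s) x) (qform (psd_mat_pow L s) x) < e"
  proof (rule eventually_mono)
    fix k assume "X k \<preceq> L + d \<cdot>\<^sub>m 1\<^sub>m m \<and> L \<preceq> X k + d \<cdot>\<^sub>m 1\<^sub>m m"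
    with pow_stability[OF X L d s _ x, of k] pow_stability[OF L X d s _ x, of k]
    show "dist (qform (psd_mat_pow (X k) s) x) (qform (psd_mat_pow L s) x) < e"
      using cx unfolding ds dist_real_def by (auto simp: abs_less_iff)
  qed
qed

lemma entrywise_lim_qform:
  assumes "entrywise_lim X L" "x \<in> vs"
  shows "(\<lambda>k. qform (X k) x) \<longlonglongrightarrow> qform L x"
proof -
  have sq: "X k \<in> sq" "L \<in> sq" for k using assms by (auto simp: entrywise_lim_def)
  show ?thesis unfolding qform_sum[OF sq(1) assms(2)] qform_sum[OF sq(2) assms(2)]
    using assms(1) by (intro tendsto_intros) (auto simp: entrywise_lim_def)
qed

lemma entrywise_lim_pow_add_scalar:
  assumes M: "psd M" and t: "0 \<le> t" and e: "e \<longlonglongrightarrow> 0" "\<And>k. 0 \<le> e k"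
  shows "entrywise_lim (\<lambda>k. psd_mat_pow (M + e k \<cdot>\<^sub>m 1\<^sub>m m) t) (psd_mat_pow M t)"
proof -
  obtain Q d where Q: "Q \<in> sq" "\<forall>i<m. 0 \<le> d i"
    "\<And>r. psd_mat_pow M r = spectral Q (\<lambda>i. nonneg_pow (d i) r)"
    "\<And>e r. 0 \<le> e \<Longrightarrow>
      psd_mat_pow (M + e \<cdot>\<^sub>m 1\<^sub>m m) r = spectral Q (\<lambda>i. nonneg_pow (d i + e) r)"
    using psd_pow_add_scalar[OF M] by metis
  show ?thesis
    unfolding entrywise_lim_def Q(3) Q(4)[OF e(2)]
  proof (intro conjI allI impI)
    fix i j assume ij: "i < m" "j < m"
    show "(\<lambda>k. spectral Q (\<lambda>i. nonneg_pow (d i + e k) t) $$ (i, j))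
        \<longlonglongrightarrow> spectral Q (\<lambda>i. nonneg_pow (d i) t) $$ (i, j)"
      unfolding spectral_index[OF Q(1) ij]
      using Q(2) by (intro tendsto_sum tendsto_mult tendsto_const tendsto_nonneg_pow t e) auto
  qed (use Q(1) in auto)
qed

lemma psd_pow_congruence:
  assumes "psd M" "psd N"
  shows "psd (psd_mat_pow M r * psd_mat_pow N p * psd_mat_pow M r)"
  using psd_congruence[of "psd_mat_pow M r" "psd_mat_pow N p"] psd_psd_mat_pow[OF assms(1)]
    psd_psd_mat_pow[OF assms(2)] symmD(2)[OF psdD(1)[OF psd_psd_mat_pow[OF assms(1)]]]
  by (simp del: assoc_mult_mat)

text \<open>
  Along \<open>A + e * I\<close> and \<open>B + e * I\<close> both sides converge: simple powers because the eigenvectors do not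
  change, the outer power \<open>1/q\<close> because it has exponent at most 1.
\<close>

theorem furuta_psd:
  assumes A: "psd A" and B: "psd B" and le: "B \<preceq> A"
    and r: "0 \<le> r" and p: "0 \<le> p" and q: "1 \<le> q" and pq: "p + 2 * r \<le> (1 + 2 * r) * q"
  shows "psd_mat_pow B ((p + 2 * r) / q)
      \<preceq> psd_mat_pow (psd_mat_pow B r * psd_mat_pow A p * psd_mat_pow B r) (1 / q)" (is ?lower)
    and "psd_mat_pow (psd_mat_pow A r * psd_mat_pow B p * psd_mat_pow A r) (1 / q)
      \<preceq> psd_mat_pow A ((p + 2 * r) / q)" (is ?upper)
proof -
  define e :: "nat \<Rightarrow> real" where "e k = inverse (Suc k)" for k
  have e0: "e \<longlonglongrightarrow> 0" unfolding e_def by (rule LIMSEQ_inverse_real_of_nat)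
  have e: "0 < e k" "0 \<le> e k" for k by (simp_all add: e_def)
  define Ae where "Ae k = A + e k \<cdot>\<^sub>m 1\<^sub>m m" for k
  define Be where "Be k = B + e k \<cdot>\<^sub>m 1\<^sub>m m" for k
  have Ae: "pd (Ae k)" and Be: "pd (Be k)" for k
    using pd_add_scalar A B e(1) by (simp_all add: Ae_def Be_def)
  have le_e: "Be k \<preceq> Ae k" for k
    using le A B by (simp add: loewner_le_def Ae_def Be_def qform_add_scalar)
  have limA: "entrywise_lim (\<lambda>k. psd_mat_pow (Ae k) t) (psd_mat_pow A t)" if "0 \<le> t" for t
    unfolding Ae_def by (rule entrywise_lim_pow_add_scalar[OF A that e0 e(2)])
  have limB: "entrywise_lim (\<lambda>k. psd_mat_pow (Be k) t) (psd_mat_pow B t)" if "0 \<le> t" for t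
    unfolding Be_def by (rule entrywise_lim_pow_add_scalar[OF B that e0 e(2)])
  have t: "0 \<le> (p + 2 * r) / q" and q': "0 < 1 / q" "1 / q \<le> 1" using r p q by simp_all
  show ?lower
    unfolding loewner_le_def
  proof safe
    fix x assume x: "x \<in> vs"
    show "qform (psd_mat_pow B ((p + 2 * r) / q)) x
      \<le> qform (psd_mat_pow (psd_mat_pow B r * psd_mat_pow A p * psd_mat_pow B r) (1 / q)) x"
    proof (rule LIMSEQ_le)
      show "(\<lambda>k. qform (psd_mat_pow (Be k) ((p + 2 * r) / q)) x)
          \<longlonglongrightarrow> qform (psd_mat_pow B ((p + 2 * r) / q)) x"
        by (rule entrywise_lim_qform[OF limB[OF t] x])
      show "(\<lambda>k. qform (psd_mat_pow
            (psd_mat_pow (Be k) r * psd_mat_pow (Ae k) p * psd_mat_pow (Be k) r) (1 / q)) x)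
          \<longlonglongrightarrow> qform (psd_mat_pow (psd_mat_pow B r * psd_mat_pow A p * psd_mat_pow B r) (1 / q)) x"
        by (rule tendsto_qform_pow[OF entrywise_lim_mult[OF entrywise_lim_mult[OF limB[OF r]
                limA[OF p]] limB[OF r]] _ _ q' x])
          (use psd_pow_congruence A B Ae Be pd_imp_psd in blast)+
      show "\<exists>N. \<forall>k\<ge>N. qform (psd_mat_pow (Be k) ((p + 2 * r) / q)) x
          \<le> qform (psd_mat_pow
              (psd_mat_pow (Be k) r * psd_mat_pow (Ae k) p * psd_mat_pow (Be k) r) (1 / q)) x"
        using loewner_leD[OF furuta_pd_lower[OF Ae Be le_e r p q pq] x] by blast
    qed
  qed
  show ?upper
    unfolding loewner_le_def
  proof safe
    fix x assume x: "x \<in> vs"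
    show "qform (psd_mat_pow (psd_mat_pow A r * psd_mat_pow B p * psd_mat_pow A r) (1 / q)) x
      \<le> qform (psd_mat_pow A ((p + 2 * r) / q)) x"
    proof (rule LIMSEQ_le)
      show "(\<lambda>k. qform (psd_mat_pow (Ae k) ((p + 2 * r) / q)) x)
          \<longlonglongrightarrow> qform (psd_mat_pow A ((p + 2 * r) / q)) x"
        by (rule entrywise_lim_qform[OF limA[OF t] x])
      show "(\<lambda>k. qform (psd_mat_pow
            (psd_mat_pow (Ae k) r * psd_mat_pow (Be k) p * psd_mat_pow (Ae k) r) (1 / q)) x)
          \<longlonglongrightarrow> qform (psd_mat_pow (psd_mat_pow A r * psd_mat_pow B p * psd_mat_pow A r) (1 / q)) x"
        by (rule tendsto_qform_pow[OF entrywise_lim_mult[OF entrywise_lim_mult[OF limA[OF r]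
                limB[OF p]] limA[OF r]] _ _ q' x])
          (use psd_pow_congruence A B Ae Be pd_imp_psd in blast)+
      show "\<exists>N. \<forall>k\<ge>N. qform (psd_mat_pow
            (psd_mat_pow (Ae k) r * psd_mat_pow (Be k) p * psd_mat_pow (Ae k) r) (1 / q)) x
          \<le> qform (psd_mat_pow (Ae k) ((p + 2 * r) / q)) x"
        using loewner_leD[OF furuta_pd_upper[OF Ae Be le_e r p q pq] x] by blast
    qed
  qed
qed

end

section \<open>Block circulant matrices and tensors\<close>

text \<open>
  Index identities for the block position \<open>(a - b) mod c\<close>: exchanging row and column negates it, and
  moving both by one leaves it unchanged.
\<close>

lemma mod_sub_negate:
  fixes a b c :: nat
  assumes "a < c" "b < c"
  shows "(c - (a + c - b) mod c) mod c = (b + c - a) mod c"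
proof -
  consider "a < b" | "a = b" | "b < a" by linarith
  then show ?thesis
  proof cases
    case 1
    then have "(a + c - b) mod c = a + c - b" using assms by simp
    moreover have "c - (a + c - b) = b - a" "b + c - a = (b - a) + c" using 1 assms by simp_all
    ultimately show ?thesis using mod_add_self2[of "b - a" c] by presburger
  next
    case 2
    then show ?thesis using assms by simp
  next
    case 3
    then have "a + c - b = (a - b) + c" by simp
    then have "(a + c - b) mod c = (a - b) mod c" by (simp only: mod_add_self2)
    also have "\<dots> = a - b" using assms by simp
    finally have "(a + c - b) mod c = a - b" .
    moreover have "c - (a - b) = b + c - a" using 3 assms by simp
    ultimately show ?thesis by simp
  qed
qed

lemma mod_sub_Suc:
  fixes a b c :: nat
  assumes "a < c" "b < c"
  shows "(Suc a mod c + c - Suc b mod c) mod c = (a + c - b) mod c"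
proof -
  have S: "Suc x mod c = (if Suc x = c then 0 else Suc x)" if "x < c" for x
    using that by auto
  consider "Suc a = c" "Suc b = c" | "Suc a = c" "Suc b \<noteq> c" | "Suc a \<noteq> c" by blast
  then show ?thesis
  proof cases
    case 1
    then have "a = b" by simp
    with 1 show ?thesis by simp
  next
    case 2
    then have "a + c - b = (c - Suc b) + c" using assms by simp
    then have "(a + c - b) mod c = (c - Suc b) mod c" by (simp only: mod_add_self2)
    then show ?thesis using 2 S[OF assms(1)] S[OF assms(2)] by simp
  next
    case 3
    show ?thesis
    proof (cases "Suc b = c")
      case True
      then have "a + c - b = Suc a" "Suc a mod c + c - Suc b mod c = Suc a + c"
        using 3 assms by auto
      then show ?thesis by (simp only: mod_add_self2)
    next
      case False
      then show ?thesis using 3 S[OF assms(1)] S[OF assms(2)] by simp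
    qed
  qed
qed

locale tensor_dim = fixed_dim "n * n3" for n n3 :: nat +
  assumes n: "n > 0" and n3: "n3 > 0"
begin

abbreviation "N \<equiv> n * n3"
abbreviation "tensors \<equiv> carrier_tensor n n n3"

lemma div_less: "i < N \<Longrightarrow> i div n < n3"
  by (simp add: less_mult_imp_div_less mult.commute)

lemma block_less: "k < n3 \<Longrightarrow> i < n \<Longrightarrow> k * n + i < N"
proof -
  assume "k < n3" "i < n"
  then have "k * n + i < Suc k * n" by simp
  also have "\<dots> \<le> n3 * n" using \<open>k < n3\<close> by (intro mult_right_mono) auto
  finally show ?thesis by (simp add: mult.commute)
qed

lemma bcirc_carrier [simp]: "A \<in> tensors \<Longrightarrow> bcirc A \<in> sq"
  using carrier_tensorD[of A n n n3] n3 by (auto simp: bcirc_def Let_def)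

lemma bcirc_index:
  assumes "A \<in> tensors" "i < N" "j < N"
  shows "bcirc A $$ (i, j) = (A ! ((i div n + n3 - j div n) mod n3)) $$ (i mod n, j mod n)"
  using carrier_tensorD[of A n n n3] n3 assms by (simp add: bcirc_def Let_def)

text \<open>
  Adding \<open>n\<close> to an index moves it to the same place in the cyclically next block.
\<close>

definition shift :: "nat \<Rightarrow> nat" where "shift i = (i + n) mod N"

lemma shift_less [simp]: "shift i < N"
  using n n3 by (simp add: shift_def)

lemma shift_div [simp]: "shift i div n = Suc (i div n) mod n3"
  using n n3 by (simp add: shift_def mod_mult2_eq)

lemma shift_mod [simp]: "shift i mod n = i mod n"
  using n n3 by (simp add: shift_def mod_mult2_eq)

lemma shift_block: "i < n \<Longrightarrow> shift (k * n + i) = (Suc k mod n3) * n + i"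
  using n n3 div_mult_mod_eq[of "shift (k * n + i)" n] by simp

lemma shift_inj: "i < N \<Longrightarrow> j < N \<Longrightarrow> shift i = shift j \<longleftrightarrow> i = j"
proof
  define unshift where "unshift i = (i + (N - n)) mod N" for i
  have "n \<le> N" using n3 by simp
  then have unshift: "unshift (shift i) = (i + N) mod N" for i
    using mod_add_left_eq[of "i + n" N "N - n"] by (simp add: unshift_def shift_def)
  have "unshift (shift i) = i" if "i < N" for i
    unfolding unshift using that by simp
  then show "i < N \<Longrightarrow> j < N \<Longrightarrow> shift i = shift j \<Longrightarrow> i = j" by metis
qed simp

lemma shift_image: "shift ` {..<N} = {..<N}"
  using shift_inj by (intro endo_inj_surj) (auto simp: inj_on_def)

definition circulant :: "real mat \<Rightarrow> bool" where
  "circulant M \<longleftrightarrow> M \<in> sq \<and> (\<forall>i<N. \<forall>j<N. M $$ (shift i, shift j) = M $$ (i, j))"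

definition shift_mat :: "real mat" where
  "shift_mat = mat N N (\<lambda>(i, j). if i = shift j then 1 else 0)"

lemma shift_mat_sq [simp]: "shift_mat \<in> sq"
  by (simp add: shift_mat_def)

text \<open>
  Commutation is what products and spectral powers visibly inherit.
\<close>

lemma circulant_iff_commute:
  assumes M: "M \<in> sq"
  shows "circulant M \<longleftrightarrow> M * shift_mat = shift_mat * M"
proof -
  have left: "(M * shift_mat) $$ (i, j) = M $$ (i, shift j)" if "i < N" "j < N" for i j
  proof -
    have "(M * shift_mat) $$ (i, j) = (\<Sum>k<N. if k = shift j then M $$ (i, k) else 0)"
      unfolding sq_mult_index[OF M shift_mat_sq that]
      using that by (intro sum.cong) (auto simp: shift_mat_def)
    then show ?thesis by simp
  qed
  have right: "(shift_mat * M) $$ (shift i, j) = M $$ (i, j)" if "i < N" "j < N" for i j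
  proof -
    have "(shift_mat * M) $$ (shift i, j) = (\<Sum>k<N. if i = k then M $$ (k, j) else 0)"
      unfolding sq_mult_index[OF shift_mat_sq M shift_less that(2)]
      using that shift_inj by (intro sum.cong) (auto simp: shift_mat_def)
    then show ?thesis using that by simp
  qed
  have "circulant M \<longleftrightarrow> (\<forall>i<N. \<forall>j<N. (M * shift_mat) $$ (shift i, j) = (shift_mat * M) $$ (shift i, j))"
    using M by (simp add: circulant_def left right del: index_mult_mat(1))
  also have "\<dots> \<longleftrightarrow> (\<forall>i\<in>shift ` {..<N}. \<forall>j<N. (M * shift_mat) $$ (i, j) = (shift_mat * M) $$ (i, j))"
    by (fastforce simp del: index_mult_mat(1))
  also have "\<dots> \<longleftrightarrow> M * shift_mat = shift_mat * M"
  proof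
    assume *: "\<forall>i\<in>shift ` {..<N}. \<forall>j<N. (M * shift_mat) $$ (i, j) = (shift_mat * M) $$ (i, j)"
    show "M * shift_mat = shift_mat * M"
    proof (rule eq_matI)
      fix i j assume "i < dim_row (shift_mat * M)" "j < dim_col (shift_mat * M)"
      then show "(M * shift_mat) $$ (i, j) = (shift_mat * M) $$ (i, j)"
        using * M carrier_matD[OF shift_mat_sq] unfolding shift_image
        by (simp del: index_mult_mat(1))
    qed (use M carrier_matD[OF shift_mat_sq] in auto)
  qed simp
  finally show ?thesis .
qed

lemma circulant_bcirc: "A \<in> tensors \<Longrightarrow> circulant (bcirc A)"
  by (simp add: circulant_def bcirc_index div_less mod_sub_Suc)

lemma circulant_block_shift:
  assumes M: "circulant M" and "k < n3" "i < n" "j < n"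
  shows "M $$ (((k + l) mod n3) * n + i, (l mod n3) * n + j) = M $$ (k * n + i, j)"
proof (induction l)
  case 0
  then show ?case using assms by simp
next
  case (Suc l)
  have less: "((k + l) mod n3) * n + i < N" "(l mod n3) * n + j < N"
    using assms n3 by (auto intro!: block_less)
  have "M $$ (shift (((k + l) mod n3) * n + i), shift ((l mod n3) * n + j))
      = M $$ (((k + l) mod n3) * n + i, (l mod n3) * n + j)"
    using M less by (simp add: circulant_def)
  then show ?case using Suc assms by (simp add: shift_block mod_Suc_eq)
qed

text \<open>
  Invariance under the shift allows one to move any block of \<open>M\<close> into the first block column.
\<close>

lemma circulant_imp_bcirc:
  assumes M: "circulant M"
  shows "\<exists>C \<in> tensors. bcirc C = M"
proof
  define C where "C = map (\<lambda>k. mat n n (\<lambda>(i, j). M $$ (k * n + i, j))) [0..<n3]"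
  show C: "C \<in> tensors" by (auto simp: C_def carrier_tensor_def)
  show "bcirc C = M"
  proof (rule eq_matI)
    have M': "M \<in> sq" using M by (simp add: circulant_def)
    show "dim_row (bcirc C) = dim_row M" "dim_col (bcirc C) = dim_col M"
      using carrier_matD[OF bcirc_carrier[OF C]] carrier_matD[OF M'] by simp_all
    fix i j assume "i < dim_row M" "j < dim_col M"
    then have ij: "i < N" "j < N" using M' by simp_all
    define k where "k = (i div n + n3 - j div n) mod n3"
    have k: "k < n3" using n3 by (simp add: k_def)
    have d: "j div n < n3" "i div n < n3" using ij div_less by auto
    have "(k + j div n) mod n3 = (i div n + n3 - j div n + j div n) mod n3"
      unfolding k_def by (rule mod_add_left_eq)
    then have kj: "(k + j div n) mod n3 = i div n" using d by simp
    have "bcirc C $$ (i, j) = M $$ (k * n + i mod n, j mod n)"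
      unfolding bcirc_index[OF C ij] k_def[symmetric] using k n by (simp add: C_def)
    also have "\<dots> = M $$ (((k + j div n) mod n3) * n + i mod n, (j div n mod n3) * n + j mod n)"
      using circulant_block_shift[OF M k, of "i mod n" "j mod n" "j div n"] n by simp
    also have "\<dots> = M $$ (i, j)" unfolding kj using d by simp
    finally show "bcirc C $$ (i, j) = M $$ (i, j)" .
  qed
qed

text \<open>
  The product of the two matrices is circulant, hence of the form \<open>bcirc C\<close>. Its first block column is
  \<open>bcirc A * t_unfold B\<close>, and folding this column gives \<open>C\<close> on the one hand and \<open>A *\<^sub>t B\<close> on the other.
\<close>

lemma t_prod_carrier_bcirc:
  assumes A: "A \<in> tensors" and B: "B \<in> tensors"
  shows "A *\<^sub>t B \<in> tensors" and "bcirc (A *\<^sub>t B) = bcirc A * bcirc B"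
proof -
  have sq: "bcirc A \<in> sq" "bcirc B \<in> sq" using A B by simp_all
  note comm = circulant_bcirc[OF A, unfolded circulant_iff_commute[OF sq(1)]]
    circulant_bcirc[OF B, unfolded circulant_iff_commute[OF sq(2)]]
  have "bcirc A * bcirc B * shift_mat = bcirc A * (shift_mat * bcirc B)"
    using sq comm(2) by (simp add: sq_assoc)
  also have "\<dots> = bcirc A * shift_mat * bcirc B" using sq by (simp add: sq_assoc)
  also have "\<dots> = shift_mat * (bcirc A * bcirc B)" unfolding comm(1) using sq by (simp add: sq_assoc)
  finally have "circulant (bcirc A * bcirc B)"
    using sq by (simp add: circulant_iff_commute)
  then obtain C where C: "C \<in> tensors" "bcirc C = bcirc A * bcirc B"
    using circulant_imp_bcirc by blast
  have unf: "t_unfold X = mat N n (\<lambda>(i, j). bcirc X $$ (i, j))" if "X \<in> tensors" for X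
    using carrier_tensorD[OF that] n3 by (simp add: t_unfold_def)
  have "bcirc A * t_unfold B = t_unfold C"
  proof (rule eq_matI)
    fix i j assume "i < dim_row (t_unfold C)" "j < dim_col (t_unfold C)"
    then have ij: "i < N" "j < n" by (simp_all add: unf C)
    then have j: "j < N" using n3 by (metis less_le_trans mult.right_neutral nat_mult_le_cancel_disj Suc_leI One_nat_def)
    have "col (t_unfold B) j = col (bcirc B) j"
      using ij j carrier_matD[OF sq(2)] by (intro eq_vecI) (auto simp: unf B)
    then show "(bcirc A * t_unfold B) $$ (i, j) = t_unfold C $$ (i, j)"
      using ij j carrier_matD[OF sq(1)] carrier_matD[OF sq(2)] by (simp add: unf B C)
  qed (use carrier_matD[OF sq(1)] in \<open>simp_all add: unf B C(1)\<close>)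
  then have "A *\<^sub>t B = C"
    using t_fold_unfold[OF C(1) n3] carrier_tensorD(1)[OF A] by (simp add: t_prod_def)
  with C show "A *\<^sub>t B \<in> tensors" "bcirc (A *\<^sub>t B) = bcirc A * bcirc B" by simp_all
qed

lemma t_transpose_nth:
  assumes A: "A \<in> tensors" and k: "k < n3"
  shows "t_transpose A ! k = (A ! ((n3 - k) mod n3))\<^sup>T"
proof (cases A)
  case Nil
  then show ?thesis using carrier_tensorD(1)[OF A] k by simp
next
  case (Cons S Ss)
  then have len: "n3 = Suc (length Ss)" using carrier_tensorD(1)[OF A] by simp
  show ?thesis
  proof (cases k)
    case 0
    then show ?thesis using Cons by (simp add: t_transpose_def)
  next
    case (Suc l)
    then have "l < length Ss" "(n3 - k) mod n3 = Suc (length Ss - Suc l)"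
      using k len by auto
    then show ?thesis using Cons Suc by (simp add: t_transpose_def rev_nth)
  qed
qed

lemma t_transpose_carrier: "A \<in> tensors \<Longrightarrow> t_transpose A \<in> tensors"
  by (cases A) (auto simp: t_transpose_def carrier_tensor_def)

lemma bcirc_t_transpose:
  assumes A: "A \<in> tensors"
  shows "bcirc (t_transpose A) = (bcirc A)\<^sup>T"
proof (rule eq_matI)
  note AT = t_transpose_carrier[OF A]
  show "dim_row (bcirc (t_transpose A)) = dim_row (bcirc A)\<^sup>T"
    "dim_col (bcirc (t_transpose A)) = dim_col (bcirc A)\<^sup>T"
    using carrier_matD[OF bcirc_carrier[OF A]] carrier_matD[OF bcirc_carrier[OF AT]] by simp_all
  fix i j assume "i < dim_row (bcirc A)\<^sup>T" "j < dim_col (bcirc A)\<^sup>T"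
  then have ij: "i < N" "j < N" using carrier_matD[OF bcirc_carrier[OF A]] by simp_all
  define k where "k = (j div n + n3 - i div n) mod n3"
  have k: "k < n3" using n3 by (simp add: k_def)
  have "(n3 - (i div n + n3 - j div n) mod n3) mod n3 = k"
    unfolding k_def using ij div_less by (intro mod_sub_negate)
  then have "bcirc (t_transpose A) $$ (i, j) = (A ! k)\<^sup>T $$ (i mod n, j mod n)"
    using n3 by (simp add: bcirc_index[OF AT ij] t_transpose_nth[OF A])
  also have "\<dots> = (A ! k) $$ (j mod n, i mod n)"
    using carrier_tensorD(2)[OF A k] n by simp
  also have "\<dots> = bcirc A $$ (j, i)" by (simp add: bcirc_index[OF A ij(2,1)] k_def)
  also have "\<dots> = (bcirc A)\<^sup>T $$ (i, j)"
    using ij carrier_matD[OF bcirc_carrier[OF A]] by simp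
  finally show "bcirc (t_transpose A) $$ (i, j) = (bcirc A)\<^sup>T $$ (i, j)" .
qed

lemma t_symmetric_iff: "A \<in> tensors \<Longrightarrow> t_symmetric A \<longleftrightarrow> symm (bcirc A)"
  using bcirc_inj[OF t_transpose_carrier[of A] _ n3, of A] bcirc_t_transpose[of A]
  by (auto simp: t_symmetric_def symm_def)

lemma t_minus_carrier: "A \<in> tensors \<Longrightarrow> B \<in> tensors \<Longrightarrow> t_minus A B \<in> tensors"
proof -
  assume AB: "A \<in> tensors" "B \<in> tensors"
  have "x - y \<in> carrier_mat n n" if "(x, y) \<in> set (zip A B)" for x y
    using set_zip_leftD[OF that] set_zip_rightD[OF that] AB
    by (auto simp: carrier_tensor_def subset_iff intro: minus_carrier_mat)
  with AB show ?thesis by (auto simp: t_minus_def carrier_tensor_def)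
qed

lemma bcirc_t_minus:
  assumes A: "A \<in> tensors" and B: "B \<in> tensors"
  shows "bcirc (t_minus A B) = bcirc A - bcirc B"
proof (rule eq_matI)
  note C = t_minus_carrier[OF A B]
  show "dim_row (bcirc (t_minus A B)) = dim_row (bcirc A - bcirc B)"
    "dim_col (bcirc (t_minus A B)) = dim_col (bcirc A - bcirc B)"
    using carrier_matD[OF bcirc_carrier[OF B]] carrier_matD[OF bcirc_carrier[OF C]] by simp_all
  fix i j assume "i < dim_row (bcirc A - bcirc B)" "j < dim_col (bcirc A - bcirc B)"
  then have ij: "i < N" "j < N" using carrier_matD[OF bcirc_carrier[OF B]] by simp_all
  define k where "k = (i div n + n3 - j div n) mod n3"
  have k: "k < n3" using n3 by (simp add: k_def)
  have "t_minus A B ! k = A ! k - B ! k"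
    using k carrier_tensorD(1)[OF A] carrier_tensorD(1)[OF B] by (simp add: t_minus_def)
  then show "bcirc (t_minus A B) $$ (i, j) = (bcirc A - bcirc B) $$ (i, j)"
    using bcirc_index[OF A ij] bcirc_index[OF B ij] bcirc_index[OF C ij] ij n
      carrier_matD[OF bcirc_carrier[OF B]] carrier_matD[OF carrier_tensorD(2)[OF B k]]
    by (simp add: k_def)
qed

definition flatten :: "tensor \<Rightarrow> real vec" where
  "flatten X = vec N (\<lambda>i. (X ! (i div n)) $$ (i mod n, 0))"

lemma sum_blocks: "(\<Sum>i<n. \<Sum>k<n3. f (k * n + i)) = (\<Sum>l<N. f l)" for f :: "nat \<Rightarrow> real"
proof -
  have "(\<Sum>k<n3. sum f {k * n..<k * n + n}) = (\<Sum>k<n3. \<Sum>i<n. f (k * n + i))"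
    by (simp add: sum.shift_bounds_nat_ivl[of f 0 _ n, simplified] atLeast0LessThan[symmetric]
        sum.atLeastLessThan_shift_0[of f] add.commute)
  then show ?thesis
    using sum.nat_group[of f n n3] sum.swap[of "\<lambda>i k. f (k * n + i)" "{..<n3}" "{..<n}"]
    by (simp add: mult.commute)
qed

lemma t_inner_t_prod:
  assumes A: "A \<in> tensors" and X: "X \<in> carrier_tensor n 1 n3"
  shows "t_inner X (A *\<^sub>t X) = qform (bcirc A) (flatten X)"
proof -
  note d = carrier_tensorD(1)[OF X] carrier_tensorD(3,4)[OF X n3]
  have blk: "(k * n + i) div n = k" "(k * n + i) mod n = i" if "i < n" for k i
    using that by simp_all
  have col: "col (t_unfold X) 0 = flatten X"
  proof (rule eq_vecI)
    fix l assume "l < dim_vec (flatten X)"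
    then have l: "l < N" by (simp add: flatten_def)
    have "t_unfold X $$ (l div n * n + l mod n, 0) = X ! (l div n) $$ (l mod n, 0)"
      by (rule t_unfold_index(1)[OF X]) (use l n div_less in auto)
    then show "col (t_unfold X) 0 $ l = flatten X $ l"
      using l by (simp add: t_unfold_def d flatten_def)
  qed (simp add: t_unfold_def d flatten_def)
  have prod: "(A *\<^sub>t X) ! k $$ (i, 0) = (bcirc A *\<^sub>v flatten X) $ (k * n + i)"
    if "k < n3" "i < n" for k i
  proof -
    have dim: "dim_row (bcirc A * t_unfold X) = N" "dim_col (bcirc A * t_unfold X) = 1"
      using carrier_matD[OF bcirc_carrier[OF A]] by (simp_all add: t_unfold_def d)
    have "(A *\<^sub>t X) ! k $$ (i, 0) = (bcirc A * t_unfold X) $$ (k * n + i, 0)"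
      using that n3 carrier_tensorD(1)[OF A] dim by (simp add: t_prod_def t_fold_def Let_def)
    also have "\<dots> = row (bcirc A) (k * n + i) \<bullet> col (t_unfold X) 0"
      using block_less[OF that] dim by (intro index_mult_mat(1)) auto
    finally show ?thesis
      using block_less[OF that] carrier_matD[OF bcirc_carrier[OF A]] by (simp add: col)
  qed
  have "t_inner X (A *\<^sub>t X)
      = (\<Sum>i<n. \<Sum>k<n3. flatten X $ (k * n + i) * (bcirc A *\<^sub>v flatten X) $ (k * n + i))"
    unfolding t_inner_def d
    using block_less by (simp add: prod flatten_def blk)
  also have "\<dots> = qform (bcirc A) (flatten X)"
    unfolding sum_blocks[of "\<lambda>l. flatten X $ l * (bcirc A *\<^sub>v flatten X) $ l"]
    using carrier_matD[OF bcirc_carrier[OF A]] by (simp only: scalar_prod_def dim_mult_mat_vec atLeast0LessThan)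
  finally show ?thesis .
qed

lemma flatten_surj:
  assumes "x \<in> vs"
  obtains X where "X \<in> carrier_tensor n 1 n3" "flatten X = x"
proof
  let ?X = "map (\<lambda>k. mat n 1 (\<lambda>(i, j). x $ (k * n + i))) [0..<n3]"
  show "?X \<in> carrier_tensor n 1 n3" by (auto simp: carrier_tensor_def)
  show "flatten ?X = x" using assms n div_less by (intro eq_vecI) (auto simp: flatten_def)
qed

lemma flatten_carrier [simp]: "flatten X \<in> vs"
  by (simp add: flatten_def)

lemma flatten_zero: "flatten (t_zero n 1 n3) = 0\<^sub>v N"
  using n div_less by (intro eq_vecI) (auto simp: flatten_def t_zero_def)

text \<open>
  Flattening identifies the tensors of width 1 with the vectors, and the inner product with the
  quadratic form. The excluded zero tensor only contributes the value 0.
\<close>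

lemma t_psd_iff: "t_psd n n3 A \<longleftrightarrow> A \<in> tensors \<and> psd (bcirc A)"
proof (cases "A \<in> tensors")
  case True
  have "(\<forall>X \<in> carrier_tensor n 1 n3. X \<noteq> t_zero n 1 n3 \<longrightarrow> t_inner X (A *\<^sub>t X) \<ge> 0)
      \<longleftrightarrow> (\<forall>x\<in>vs. 0 \<le> qform (bcirc A) x)"
  proof safe
    fix x assume *: "\<forall>X \<in> carrier_tensor n 1 n3. X \<noteq> t_zero n 1 n3 \<longrightarrow> t_inner X (A *\<^sub>t X) \<ge> 0"
      and "x \<in> vs"
    then obtain X where X: "X \<in> carrier_tensor n 1 n3" "flatten X = x" using flatten_surj by blast
    show "0 \<le> qform (bcirc A) x"
    proof (cases "X = t_zero n 1 n3")
      case True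
      then show ?thesis using X(2) flatten_zero bcirc_carrier[OF \<open>A \<in> tensors\<close>] by auto
    next
      case False
      then show ?thesis using * X t_inner_t_prod[OF True] by auto
    qed
  next
    fix X assume "\<forall>x\<in>vs. 0 \<le> qform (bcirc A) x" "X \<in> carrier_tensor n 1 n3"
    then show "0 \<le> t_inner X (A *\<^sub>t X)" using t_inner_t_prod[OF True] by simp
  qed
  then show ?thesis using True t_symmetric_iff by (simp add: t_psd_def psd_def)
qed (simp add: t_psd_def)

lemma t_ge_iff:
  assumes A: "A \<in> tensors" and B: "B \<in> tensors"
  shows "t_ge n n3 A B \<longleftrightarrow> symm (bcirc A) \<and> symm (bcirc B) \<and> loewner_le (bcirc B) (bcirc A)"
proof -
  have "qform (bcirc A - bcirc B) x = qform (bcirc A) x - qform (bcirc B) x" if "x \<in> vs" for x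
    using that A B
    by (simp add: minus_mult_distrib_mat_vec[of _ N N] scalar_prod_minus_distrib[of _ N])
  moreover have "symm (bcirc A) \<Longrightarrow> symm (bcirc B) \<Longrightarrow> symm (bcirc A - bcirc B)"
    by (auto simp: symm_def transpose_minus[of _ N N] minus_carrier_mat)
  ultimately show ?thesis
    using A B t_minus_carrier[OF A B]
    by (auto simp: t_ge_def t_symmetric_iff t_psd_iff bcirc_t_minus psd_def loewner_le_def)
qed

text \<open>
  Powers commute with the shift matrix, so the power of a block circulant matrix is the image
  of a tensor, and the description that defines \<open>A ^\<^sub>t r\<close> is satisfied.
\<close>

lemma t_pow_carrier_bcirc:
  assumes A: "A \<in> tensors" and psd: "psd (bcirc A)"
  shows "A ^\<^sub>t r \<in> tensors" and "bcirc (A ^\<^sub>t r) = psd_mat_pow (bcirc A) r"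
proof -
  have "bcirc A * shift_mat = shift_mat * bcirc A"
    using circulant_bcirc[OF A] circulant_iff_commute bcirc_carrier[OF A] by blast
  then have "psd_mat_pow (bcirc A) r * shift_mat = shift_mat * psd_mat_pow (bcirc A) r"
    by (rule psd_mat_pow_intertwine[OF psd psd shift_mat_sq])
  then have "circulant (psd_mat_pow (bcirc A) r)"
    using circulant_iff_commute psd_sq[OF psd_psd_mat_pow[OF psd]] by blast
  then obtain C where C: "C \<in> tensors" "bcirc C = psd_mat_pow (bcirc A) r"
    using circulant_imp_bcirc by blast
  have "A ^\<^sub>t r = (THE C. C \<in> tensors \<and> bcirc C = psd_mat_pow (bcirc A) r)"
    using carrier_tensorD[OF A] n3 by (simp add: t_pow_def)
  also have "\<dots> = C"
  proof (rule the_equality)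
    show "C \<in> tensors \<and> bcirc C = psd_mat_pow (bcirc A) r" using C by simp
    show "D = C" if "D \<in> tensors \<and> bcirc D = psd_mat_pow (bcirc A) r" for D
      using bcirc_inj[OF _ C(1) n3, of D] that C(2) by simp
  qed
  finally show "A ^\<^sub>t r \<in> tensors" "bcirc (A ^\<^sub>t r) = psd_mat_pow (bcirc A) r"
    using C by simp_all
qed

lemma bcirc_t_pow_sandwich:
  fixes p r s :: real
  assumes A: "A \<in> tensors" "psd (bcirc A)" and B: "B \<in> tensors" "psd (bcirc B)"
  defines "K \<equiv> psd_mat_pow (bcirc A) r * psd_mat_pow (bcirc B) p * psd_mat_pow (bcirc A) r"
  shows "(A ^\<^sub>t r *\<^sub>t B ^\<^sub>t p *\<^sub>t A ^\<^sub>t r) ^\<^sub>t s \<in> tensors"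
    and "bcirc ((A ^\<^sub>t r *\<^sub>t B ^\<^sub>t p *\<^sub>t A ^\<^sub>t r) ^\<^sub>t s) = psd_mat_pow K s"
    and "psd K"
proof -
  note Ar = t_pow_carrier_bcirc[OF A, of r] and Bp = t_pow_carrier_bcirc[OF B, of p]
  note AB = t_prod_carrier_bcirc[OF Ar(1) Bp(1)]
  note ABA = t_prod_carrier_bcirc[OF AB(1) Ar(1)]
  have bc: "bcirc (A ^\<^sub>t r *\<^sub>t B ^\<^sub>t p *\<^sub>t A ^\<^sub>t r) = K"
    unfolding ABA(2) AB(2) Ar(2) Bp(2) K_def ..
  show psdK: "psd K" unfolding K_def by (rule psd_pow_congruence[OF A(2) B(2)])
  show "(A ^\<^sub>t r *\<^sub>t B ^\<^sub>t p *\<^sub>t A ^\<^sub>t r) ^\<^sub>t s \<in> tensors"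
    "bcirc ((A ^\<^sub>t r *\<^sub>t B ^\<^sub>t p *\<^sub>t A ^\<^sub>t r) ^\<^sub>t s) = psd_mat_pow K s"
    using t_pow_carrier_bcirc[OF ABA(1), of s] psdK unfolding bc by simp_all
qed

end

section \<open>The Furuta inequality for tensors\<close>

theorem theorem3p3:
  fixes A B :: tensor and n n3 :: nat and p q r :: real
  assumes "n > 0" and "n3 > 0"
    and "A \<in> carrier_tensor n n n3" and "B \<in> carrier_tensor n n n3"
    and "t_ge n n3 A B" and "t_psd n n3 B"
    and "r \<ge> 0" and "p \<ge> 0" and "q \<ge> 1"
    and "(1 + 2 * r) * q \<ge> p + 2 * r"
  shows "t_ge n n3 ((B ^\<^sub>t r *\<^sub>t A ^\<^sub>t p *\<^sub>t B ^\<^sub>t r) ^\<^sub>t (1 / q)) (B ^\<^sub>t ((p + 2 * r) / q))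
       \<and> t_ge n n3 (A ^\<^sub>t ((p + 2 * r) / q)) ((A ^\<^sub>t r *\<^sub>t B ^\<^sub>t p *\<^sub>t A ^\<^sub>t r) ^\<^sub>t (1 / q))"
proof -
  interpret tensor_dim n n3 using assms(1,2) by unfold_locales
  note A = assms(3) and B = assms(4)
  have le: "loewner_le (bcirc B) (bcirc A)" and symA: "symm (bcirc A)"
    using assms(5) t_ge_iff[OF A B] by simp_all
  have psdB: "psd (bcirc B)" using assms(6) t_psd_iff by simp
  have psdA: "psd (bcirc A)"
    using symA psdD(2)[OF psdB] loewner_leD[OF le] unfolding psd_def by (blast intro: order_trans)
  note powA = t_pow_carrier_bcirc[OF A psdA] and powB = t_pow_carrier_bcirc[OF B psdB]
  note BAB = bcirc_t_pow_sandwich[OF B psdB A psdA] and ABA = bcirc_t_pow_sandwich[OF A psdA B psdB]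
  note furuta = furuta_psd[OF psdA psdB le assms(7-10)]
  have sym: "symm (psd_mat_pow M s)" if "psd M" for M s
    using psdD(1)[OF psd_psd_mat_pow[OF that]] .
  show ?thesis
  proof
    show "t_ge n n3 ((B ^\<^sub>t r *\<^sub>t A ^\<^sub>t p *\<^sub>t B ^\<^sub>t r) ^\<^sub>t (1 / q)) (B ^\<^sub>t ((p + 2 * r) / q))"
      unfolding t_ge_iff[OF BAB(1) powB(1)] BAB(2) powB(2)
      using sym psdB BAB(3) furuta(1) by blast
    show "t_ge n n3 (A ^\<^sub>t ((p + 2 * r) / q)) ((A ^\<^sub>t r *\<^sub>t B ^\<^sub>t p *\<^sub>t A ^\<^sub>t r) ^\<^sub>t (1 / q))"
      unfolding t_ge_iff[OF powA(1) ABA(1)] ABA(2) powA(2)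
      using sym psdA ABA(3) furuta(2) by blast
  qed
qed

end
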